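(* Let $X$ be a real Banach lattice with $\dim X>1$, and let $T$ and $K$ be two non-zero semi-commuting positive operators on $X$ such that $K$ is compact. Then $T$ has non-trivial invariant closed ideals if any of the following is satisfied: \begin{enumerate} \item $r(K)=0$, or $\liminf_n\|K^nx\|^{1/n}<r(K)$ for some $0<x\in X$, or $\liminf_n\|(K^{n})^*x^*\|^{1/n}<r(K)$ for some $0<x^*\in X^*$; \item $r(TK)=0$, or $\liminf_n\|T^nx\|^{1/n}<\frac{r(TK)}{r(K)}$ for some $0<x\in X$, or $\liminf_n\|(T^{n})^*x^*\|^{1/n}<\frac{r(TK)}{r(K)}$ for some $0<x^*\in X^*$; \item there exists a quasi-nilpotent operator $S>0$ on $X$ semi-commuting with $T$; \item there exists $S\in L(X)$ such that $ST<TS$ or $ST>TS$. \end{enumerate}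
   Context: $L(X)$ is the space of bounded linear operators on $X$; $A^*$ denotes the Banach space adjoint; $r(\cdot)$ is the spectral radius. For vectors, functionals and operators, $a>0$ means $a\ge0$ and $a\ne0$, and $A>B$ (or $B<A$) means $A-B\ge 0$ and $A\neq B$. Two operators semi-commute if their commutator is positive or negative ($UV-VU\ge0$ or $UV-VU\le0$). A closed ideal means a norm-closed lattice ideal of $X$; it is non-trivial if it is different from $\{0\}$ and $X$. An operator is quasi-nilpotent if its spectral radius is $0$. For semi-commuting positive $T,K$ one has $r(TK)\le r(T)r(K)$, so $r(K)=0$ forces $r(TK)=0$; the quotient $r(TK)/r(K)$ in (2) is only considered when $r(K)>0$. *)

theory Defs
  imports "HOL-Analysis.Analysis" "HOL-Library.Lattice_Algebras"
begin

section \<open>Real Banach lattices\<close>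

text \<open>
  The superclass \<^class>\<open>lattice_ab_group_add_abs\<close> supplies the modulus \<open>\<bar>x\<bar> = sup x (- x)\<close>.
\<close>

class banach_lattice = banach + ordered_real_vector + lattice_ab_group_add_abs +
  assumes norm_mono_abs: "\<bar>x\<bar> \<le> \<bar>y\<bar> \<Longrightarrow> norm x \<le> norm y"

definition lattice_ideal :: "'a::banach_lattice set \<Rightarrow> bool" where
  "lattice_ideal J \<longleftrightarrow> subspace J \<and> (\<forall>x y. y \<in> J \<and> \<bar>x\<bar> \<le> \<bar>y\<bar> \<longrightarrow> x \<in> J)"

definition nontrivial_closed_ideal :: "'a::banach_lattice set \<Rightarrow> bool" where
  "nontrivial_closed_ideal J \<longleftrightarrow> lattice_ideal J \<and> closed J \<and> J \<noteq> {0} \<and> J \<noteq> UNIV"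

definition invariant_under :: "('a::real_normed_vector \<Rightarrow>\<^sub>L 'a) \<Rightarrow> 'a set \<Rightarrow> bool" where
  "invariant_under T J \<longleftrightarrow> (\<forall>x\<in>J. T x \<in> J)"


section \<open>Order on operators and functionals\<close>

text \<open>
  The codomain is left general so that the same notions apply to operators (\<open>'b = 'a\<close>) and to
  functionals (\<open>'b = real\<close>).
\<close>

definition positive_op :: "('a::{real_normed_vector, ord} \<Rightarrow>\<^sub>L 'b::{real_normed_vector, ord}) \<Rightarrow> bool" where
  "positive_op A \<longleftrightarrow> (\<forall>x\<ge>0. 0 \<le> A x)"

definition op_less :: "('a::{real_normed_vector, ord} \<Rightarrow>\<^sub>L 'b::{real_normed_vector, ord})
    \<Rightarrow> ('a \<Rightarrow>\<^sub>L 'b) \<Rightarrow> bool" where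
  "op_less B A \<longleftrightarrow> positive_op (A - B) \<and> A \<noteq> B"

definition semi_commute :: "('a::{real_normed_vector, ord} \<Rightarrow>\<^sub>L 'a) \<Rightarrow> ('a \<Rightarrow>\<^sub>L 'a) \<Rightarrow> bool" where
  "semi_commute U V \<longleftrightarrow>
     positive_op ((U o\<^sub>L V) - (V o\<^sub>L U)) \<or> positive_op ((V o\<^sub>L U) - (U o\<^sub>L V))"


section \<open>Compact operators, powers, adjoints\<close>

definition compact_op :: "('a::real_normed_vector \<Rightarrow>\<^sub>L 'b::real_normed_vector) \<Rightarrow> bool" where
  "compact_op K \<longleftrightarrow> compact (closure (K ` cball 0 1))"

primrec blinfun_pow :: "('a::real_normed_vector \<Rightarrow>\<^sub>L 'a) \<Rightarrow> nat \<Rightarrow> ('a \<Rightarrow>\<^sub>L 'a)" where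
  "blinfun_pow A 0 = id_blinfun"
| "blinfun_pow A (Suc n) = A o\<^sub>L blinfun_pow A n"

definition banach_adjoint ::
    "('a::real_normed_vector \<Rightarrow>\<^sub>L 'b::real_normed_vector) \<Rightarrow> ('b \<Rightarrow>\<^sub>L real) \<Rightarrow> ('a \<Rightarrow>\<^sub>L real)" where
  "banach_adjoint A f = f o\<^sub>L A"


section \<open>Spectral radius\<close>

text \<open>
  As usual, the spectrum of an operator on a real space is that of its complexification.
  A pair \<open>(x, y)\<close> stands for \<open>x + i y\<close>. Boundedness with respect to the norm of the product type is
  the same as boundedness with respect to the norm \<open>\<parallel> |x + i y| \<parallel>\<close> of the complexified Banach
  lattice, since these norms are equivalent. An inverse of a complex-linear map is itself
  complex-linear, so real linearity of \<open>R\<close> suffices in the definition of the spectrum.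
\<close>

definition complex_scale :: "complex \<Rightarrow> 'a::real_vector \<times> 'a \<Rightarrow> 'a \<times> 'a" where
  "complex_scale c z =
     (Re c *\<^sub>R fst z - Im c *\<^sub>R snd z, Re c *\<^sub>R snd z + Im c *\<^sub>R fst z)"

definition complexify_op :: "('a::real_normed_vector \<Rightarrow>\<^sub>L 'a) \<Rightarrow> 'a \<times> 'a \<Rightarrow> 'a \<times> 'a" where
  "complexify_op A z = (A (fst z), A (snd z))"

definition spectrum_op :: "('a::real_normed_vector \<Rightarrow>\<^sub>L 'a) \<Rightarrow> complex set" where
  "spectrum_op A = {c. \<not> (\<exists>R :: 'a \<times> 'a \<Rightarrow> 'a \<times> 'a. bounded_linear R \<and>
     (\<forall>z. R (complex_scale c z - complexify_op A z) = z) \<and>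
     (\<forall>z. complex_scale c (R z) - complexify_op A (R z) = z))}"

definition spectral_radius_op :: "('a::real_normed_vector \<Rightarrow>\<^sub>L 'a) \<Rightarrow> real" where
  "spectral_radius_op A = Sup (cmod ` spectrum_op A)"

definition quasi_nilpotent :: "('a::real_normed_vector \<Rightarrow>\<^sub>L 'a) \<Rightarrow> bool" where
  "quasi_nilpotent A \<longleftrightarrow> spectral_radius_op A = 0"

end

theory Submission
  imports Defs
begin

text \<open>
  Suppose that \<open>T\<close> has no non-trivial invariant closed ideal. Then there are \<open>y \<ge> 0\<close>, a positive
  functional \<open>g\<close> and \<open>t, r > 0\<close> with
  \<open>T y = t y\<close>, \<open>K y = r y\<close>, \<open>g \<circ> T = t g\<close>, \<open>g \<circ> K = r g\<close>,
  where \<open>y\<close> is quasi-interior (the ideal generated by \<open>y\<close> is dense), \<open>g\<close> is strictly positive, and the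
  eigenspace of \<open>T\<close> for \<open>t\<close> is spanned by \<open>y\<close> (theorem \<open>common_eigenvectors\<close>). Each of the conditions
  contradicts this.

  \<^item> Via the Fredholm alternative, \<open>g\<close> bounds the spectra of \<open>K\<close> and \<open>T K\<close>, so that \<open>r(K) = r\<close> and
    \<open>r(T K) = t r\<close> are positive. For \<open>x > 0\<close> one has \<open>g (K\<^sup>n x) = r\<^sup>n g x\<close> with \<open>g x > 0\<close>, and for a
    functional \<open>f > 0\<close> one has \<open>f (K\<^sup>n y) = r\<^sup>n f y\<close> with \<open>f y > 0\<close>. So the orbits grow at least like
    \<open>r\<^sup>n\<close>, and likewise those of \<open>T\<close> at least like \<open>t\<^sup>n\<close>.
  \<^item> If \<open>D = \<plusminus> (T S - S T) \<ge> 0\<close>, then \<open>g (D y) = 0\<close>. Hence \<open>D y = 0\<close>, and hence \<open>D = 0\<close>: no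
    commutator with \<open>T\<close> is positive and nonzero.
  \<^item> In particular a positive \<open>S\<close> that semi-commutes with \<open>T\<close> commutes with \<open>T\<close> and maps \<open>y\<close> to a multiple
    of \<open>y\<close>, which is nonzero if \<open>S \<noteq> 0\<close>. So \<open>S\<close> has a positive eigenvalue and is not quasi-nilpotent.

  To construct \<open>y\<close> and \<open>g\<close>, let \<open>R = (c - T)\<^sup>-\<^sup>1\<close> with \<open>c > \<parallel>T\<parallel>\<close>. A vector \<open>v = R x\<close> with \<open>x > 0\<close> satisfies
  \<open>T v \<le> c v\<close>, so the ideal generated by \<open>v\<close> is invariant and therefore dense. With this, the argument of
  Lomonosov and Hilden shows that the powers of the compact operator \<open>Q = R K\<close> decay at most
  geometrically (\<open>growth_of_powers\<close>), and the Krein--Rutman theorem yields a positive eigenvector \<open>x\<close> and a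
  positive eigenfunctional \<open>f\<close> of \<open>Q\<close> for a common eigenvalue \<open>q > 0\<close>. Their images \<open>y = R x\<close> and
  \<open>g = f \<circ> R\<close> are quasi-interior and strictly positive, and since \<open>Q\<close> and \<open>R\<close> semi-commute they are still
  eigenvectors of \<open>Q\<close> and of its adjoint. The commutator principle above, applied to \<open>Q\<close>, shows that \<open>Q\<close>
  commutes with \<open>T\<close>, and thus \<open>K\<close> commutes with \<open>T\<close>. Both eigenspaces are one-dimensional, so \<open>T\<close> and \<open>K\<close>
  act on them as scalars.

  The eigenfunctional in the Krein--Rutman theorem is obtained from a sublinear functional by the
  Hahn--Banach theorem; this avoids compactness of the adjoint.
\<close>

section \<open>Compact operators and the Fredholm alternative\<close>

lemma compact_opI:
  fixes A :: "'a::real_normed_vector \<Rightarrow>\<^sub>L 'b::real_normed_vector"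
  assumes "A ` cball 0 1 \<subseteq> C" "compact C"
  shows "compact_op A"
proof -
  have "closure (A ` cball 0 1) \<subseteq> C"
    using assms by (simp add: closure_minimal compact_imp_closed)
  then show ?thesis
    unfolding compact_op_def
    using assms(2) by (metis closed_Int_compact closed_closure inf.absorb_iff1)
qed

lemma compact_op_closure_image:
  fixes K :: "'a::real_normed_vector \<Rightarrow>\<^sub>L 'b::real_normed_vector"
  assumes "compact_op K" "bounded S"
  shows "compact (closure (K ` S))"
proof -
  obtain \<rho> where \<rho>: "\<rho> > 0" "\<And>x. x \<in> S \<Longrightarrow> norm x \<le> \<rho>"
    using \<open>bounded S\<close> by (auto simp: bounded_pos)
  have "K x \<in> (*\<^sub>R) \<rho> ` closure (K ` cball 0 1)" if "x \<in> S" for x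
  proof
    show "K x = \<rho> *\<^sub>R K (x /\<^sub>R \<rho>)"
      using \<rho>(1) by (simp add: blinfun.scaleR_right)
    have "x /\<^sub>R \<rho> \<in> cball 0 1"
      using \<rho>(1) \<rho>(2)[OF that] by (simp add: field_simps)
    then show "K (x /\<^sub>R \<rho>) \<in> closure (K ` cball 0 1)"
      by (meson closure_subset image_eqI subsetD)
  qed
  moreover have "compact ((*\<^sub>R) \<rho> ` closure (K ` cball 0 1))"
    using assms(1) unfolding compact_op_def by (rule compact_scaling)
  ultimately have "closure (K ` S) \<subseteq> (*\<^sub>R) \<rho> ` closure (K ` cball 0 1)"
    by (intro closure_minimal compact_imp_closed) auto
  with \<open>compact ((*\<^sub>R) \<rho> ` closure (K ` cball 0 1))\<close> show ?thesis
    by (metis closed_Int_compact closed_closure inf.absorb_iff1)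
qed

lemma compact_op_subsequence:
  fixes K :: "'a::real_normed_vector \<Rightarrow>\<^sub>L 'b::real_normed_vector"
  assumes "compact_op K" "\<And>n. norm (x n) \<le> b"
  obtains l r where "strict_mono (r :: nat \<Rightarrow> nat)" "(\<lambda>n. K (x (r n))) \<longlonglongrightarrow> l"
proof -
  have "seq_compact (closure (K ` cball 0 b))"
    using compact_op_closure_image[OF assms(1) bounded_cball]
    by (simp add: compact_eq_seq_compact_metric)
  moreover have "\<forall>n. K (x n) \<in> closure (K ` cball 0 b)"
    using assms(2) closure_subset[of "K ` cball 0 b"] by (simp add: image_subset_iff)
  ultimately obtain l r where "strict_mono (r :: nat \<Rightarrow> nat)" "((\<lambda>n. K (x n)) \<circ> r) \<longlonglongrightarrow> l"
    unfolding seq_compact_def by (metis (no_types, lifting))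
  then show thesis
    using that by (simp add: o_def)
qed

lemma compact_op_compose_left:
  assumes "compact_op K"
  shows "compact_op (A o\<^sub>L K)"
proof (rule compact_opI)
  show "(A o\<^sub>L K) ` cball 0 1 \<subseteq> A ` closure (K ` cball 0 1)"
    using closure_subset[of "K ` cball 0 1"] by auto
  show "compact (A ` closure (K ` cball 0 1))"
    using assms unfolding compact_op_def
    by (intro compact_continuous_image) (auto intro: continuous_intros)
qed

lemma compact_op_diff:
  assumes "compact_op A" "compact_op B"
  shows "compact_op (A - B)"
proof (rule compact_opI)
  let ?C = "{x - y | x y. x \<in> closure (A ` cball 0 1) \<and> y \<in> closure (B ` cball 0 1)}"
  show "(A - B) ` cball 0 1 \<subseteq> ?C"
    using closure_subset[of "A ` cball 0 1"] closure_subset[of "B ` cball 0 1"]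
    by (force simp: blinfun.diff_left)
  show "compact ?C"
    using assms unfolding compact_op_def by (rule compact_differences)
qed

lemma compact_op_rank_one:
  fixes f :: "'a::real_normed_vector \<Rightarrow>\<^sub>L real" and y :: "'b::real_normed_vector"
  shows "compact_op (blinfun_scaleR_left y o\<^sub>L f)"
proof (rule compact_op_compose_left, rule compact_opI)
  show "f ` cball 0 1 \<subseteq> cball 0 (norm f)"
    using norm_blinfun[of f] by (force intro: order_trans mult_left_le)
qed simp

text \<open>Along a sequence of unit vectors on which \<open>I - C\<close> tends to zero, compactness of \<open>C\<close> produces
  a limit, which is then a unit vector in the kernel.\<close>

lemma compact_op_bounded_below:
  fixes C :: "'a::real_normed_vector \<Rightarrow>\<^sub>L 'a"
  assumes C: "compact_op C" and inj: "\<And>x. C x = x \<Longrightarrow> x = 0"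
  obtains m where "m > 0" "\<And>x. m * norm x \<le> norm (x - C x)"
proof -
  have "\<exists>m>0. \<forall>x. m * norm x \<le> norm (x - C x)"
  proof (rule ccontr)
    assume "\<not> ?thesis"
    then have "\<exists>x. norm (x - C x) < inverse (real (Suc n)) * norm x" for n
      by (metis not_le of_nat_0_less_iff positive_imp_inverse_positive zero_less_Suc)
    then obtain x where x: "\<And>n. norm (x n - C (x n)) < inverse (real (Suc n)) * norm (x n)"
      by metis
    define z where "z n = x n /\<^sub>R norm (x n)" for n
    have nz: "norm (x n) > 0" for n
      using x[of n] by (metis less_le_not_le mult_zero_right norm_ge_zero order_le_less)
    then have norm_z: "norm (z n) = 1" for n
      by (simp add: z_def)
    have "norm (z n - C (z n)) \<le> inverse (real (Suc n))" for n
    proof -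
      have "z n - C (z n) = (x n - C (x n)) /\<^sub>R norm (x n)"
        by (simp add: z_def blinfun.scaleR_right scaleR_diff_right)
      then have "norm (z n - C (z n)) = norm (x n - C (x n)) / norm (x n)"
        by (simp add: divide_inverse mult.commute)
      also have "\<dots> \<le> inverse (real (Suc n))"
        using x[of n] nz[of n] by (simp only: pos_divide_le_eq less_imp_le)
      finally show ?thesis .
    qed
    then have z0: "(\<lambda>n. z n - C (z n)) \<longlonglongrightarrow> 0"
      by (rule Lim_null_comparison[OF always_eventually[OF allI] LIMSEQ_inverse_real_of_nat])
    obtain l r where r: "strict_mono (r :: nat \<Rightarrow> nat)" and l: "(\<lambda>n. C (z (r n))) \<longlonglongrightarrow> l"
      using compact_op_subsequence[OF C, of z 1] norm_z by (metis order_refl)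
    have "(\<lambda>n. (z (r n) - C (z (r n))) + C (z (r n))) \<longlonglongrightarrow> 0 + l"
      using LIMSEQ_subseq_LIMSEQ[OF z0 r] l by (intro tendsto_add) (auto simp: o_def)
    then have zl: "(\<lambda>n. z (r n)) \<longlonglongrightarrow> l"
      by simp
    then have "(\<lambda>n. C (z (r n))) \<longlonglongrightarrow> C l"
      by (intro tendsto_intros)
    then have "l = 0"
      using l inj LIMSEQ_unique by blast
    moreover have "norm l = 1"
      using tendsto_norm[OF zl] norm_z by (simp add: LIMSEQ_const_iff)
    ultimately show False
      by simp
  qed
  then show thesis
    using that by blast
qed

lemma Riesz_almost_orthogonal:
  fixes M N :: "'a::real_normed_vector set"
  assumes "subspace M" "subspace N" "closed N" "N \<subset> M"
  obtains u where "u \<in> M" "norm u = 1" "\<And>w. w \<in> N \<Longrightarrow> norm (u - w) \<ge> 1 / 2"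
proof -
  obtain a where a: "a \<in> M" "a \<notin> N"
    using assms(4) by auto
  have N0: "N \<noteq> {}"
    using assms(2) subspace_0 by auto
  define d where "d = infdist a N"
  have d: "d > 0"
    using a(2) assms(3) N0 infdist_pos_not_in_closed d_def by metis
  obtain w0 where w0: "w0 \<in> N" "dist a w0 < 2 * d"
    using cInf_lessD[of "dist a ` N" "2 * d"] N0 d by (auto simp: d_def infdist_def)
  define t where "t = norm (a - w0)"
  have t: "t > 0" "t < 2 * d"
    using w0 a by (auto simp: t_def dist_norm)
  show thesis
  proof
    show "(a - w0) /\<^sub>R t \<in> M"
      using a w0 assms by (meson psubsetD subspace_diff subspace_scale)
    show "norm ((a - w0) /\<^sub>R t) = 1"
      using t by (simp add: t_def)
    fix w assume "w \<in> N"
    then have "w0 + t *\<^sub>R w \<in> N"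
      using w0 assms(2) by (simp add: subspace_add subspace_scale)
    then have "d \<le> norm (a - (w0 + t *\<^sub>R w))"
      unfolding d_def by (metis dist_norm infdist_le)
    also have "a - (w0 + t *\<^sub>R w) = t *\<^sub>R ((a - w0) /\<^sub>R t - w)"
      using t by (simp add: scaleR_diff_right)
    finally have "d \<le> t * norm ((a - w0) /\<^sub>R t - w)"
      using t by simp
    then have "t * (1/2) < t * norm ((a - w0) /\<^sub>R t - w)"
      using t by linarith
    then show "norm ((a - w0) /\<^sub>R t - w) \<ge> 1 / 2"
      using t(1) by (metis less_imp_le mult_less_cancel_left_pos)
  qed
qed

text \<open>If \<open>A = I - C\<close> were injective but not surjective, the ranges of its powers would form a
  strictly decreasing sequence of closed subspaces. Almost orthogonal unit vectors in them would be
  mapped by \<open>C\<close> to a sequence with mutual distances at least one half.\<close>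

theorem Fredholm_alternative:
  fixes C :: "'a::banach \<Rightarrow>\<^sub>L 'a"
  assumes C: "compact_op C" and inj: "\<And>x. C x = x \<Longrightarrow> x = 0"
  shows "\<exists>R. bounded_linear R \<and> (\<forall>x. R (x - C x) = x) \<and> (\<forall>x. R x - C (R x) = x)"
proof -
  obtain m where m: "m > 0" "\<And>x. m * norm x \<le> norm (x - C x)"
    using compact_op_bounded_below[OF C inj] by blast
  define A where "A x = x - C x" for x
  have blA: "bounded_linear A"
    unfolding A_def by (intro bounded_linear_sub bounded_linear_ident blinfun.bounded_linear_right)
  then have linA: "linear A"
    by (rule bounded_linear.linear)
  have injA: "inj A"
    using inj by (simp add: linear_injective_0[OF linA] A_def)
  define Y where "Y n = (A ^^ n) ` UNIV" for n
  have Y_Suc: "Y (Suc n) = A ` Y n" for n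
    by (simp add: Y_def image_comp)
  have Y: "subspace (Y n) \<and> complete (Y n)" for n
  proof (induction n)
    case 0
    then show ?case
      by (simp add: Y_def complete_UNIV)
  next
    case (Suc n)
    then show ?case
      unfolding Y_Suc using m blA linA
      by (auto intro!: linear_subspace_image complete_isometric_image[of m] simp: A_def[symmetric])
  qed
  have Y_antimono: "Y n \<subseteq> Y k" if "k \<le> n" for k n
  proof -
    have "(A ^^ n) x = (A ^^ k) ((A ^^ (n - k)) x)" for x
      using that by (metis comp_apply funpow_add le_add_diff_inverse)
    then show ?thesis
      by (auto simp: Y_def)
  qed
  have surj: "surj A"
  proof (rule ccontr)
    assume ns: "\<not> surj A"
    have "Y (Suc n) \<subset> Y n" for n
    proof -
      have inj_n: "inj (A ^^ n)"
        using injA by (rule inj_fn)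
      have "(A ^^ n) ` A ` UNIV \<subset> (A ^^ n) ` UNIV"
        using ns inj_n by (metis inj_image_eq_iff psubsetI image_mono top_greatest)
      then show ?thesis
        by (simp add: Y_def image_comp funpow_Suc_right del: funpow.simps)
    qed
    then have "\<exists>u. u \<in> Y n \<and> norm u = 1 \<and> (\<forall>w\<in>Y (Suc n). norm (u - w) \<ge> 1/2)" for n
      using Riesz_almost_orthogonal[of "Y n" "Y (Suc n)"] Y complete_imp_closed by metis
    then obtain u where u: "\<And>n. u n \<in> Y n" "\<And>n. norm (u n) = 1"
        "\<And>n w. w \<in> Y (Suc n) \<Longrightarrow> norm (u n - w) \<ge> 1/2"
      by metis
    \<comment> \<open>\<open>C u\<^sub>n - C u\<^sub>k = u\<^sub>n - w\<close> with \<open>w\<close> in the next smaller range, because \<open>C = I - A\<close>.\<close>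
    have sep: "norm (C (u n) - C (u k)) \<ge> 1/2" if "n < k" for n k
    proof -
      have "A (u n) \<in> Y (Suc n)"
        using u(1) Y_Suc by auto
      moreover have "u k \<in> Y (Suc n)" "A (u k) \<in> Y (Suc n)"
        using u(1) Y_antimono[of "Suc n" k] Y_antimono[of "Suc n" "Suc k"] that Y_Suc[of k]
        by auto
      ultimately have "A (u n) + (u k - A (u k)) \<in> Y (Suc n)"
        using Y by (simp add: subspace_add subspace_diff)
      then have "norm (u n - (A (u n) + (u k - A (u k)))) \<ge> 1/2"
        by (rule u(3))
      then show ?thesis
        by (simp add: A_def)
    qed
    obtain l r where r: "strict_mono (r :: nat \<Rightarrow> nat)" "(\<lambda>n. C (u (r n))) \<longlonglongrightarrow> l"
      using compact_op_subsequence[OF C, of u 1] u(2) by (metis order_refl)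
    have "Cauchy (\<lambda>n. C (u (r n)))"
      using r(2) LIMSEQ_imp_Cauchy by blast
    then obtain n0 where "\<forall>m\<ge>n0. \<forall>n\<ge>n0. norm (C (u (r m)) - C (u (r n))) < 1/2"
      unfolding Cauchy_iff by (metis half_gt_zero_iff zero_less_one)
    then have "norm (C (u (r n0)) - C (u (r (Suc n0)))) < 1/2"
      by simp
    moreover have "r n0 < r (Suc n0)"
      using r(1) by (simp add: strict_mono_def)
    ultimately show False
      using sep by fastforce
  qed
  define R where "R = inv A"
  have RA: "R (A x) = x" and AR: "A (R x) = x" for x
    using injA surj by (simp_all add: R_def surj_f_inv_f)
  have "bounded_linear R"
  proof
    show "R (x + y) = R x + R y" for x y
      using RA[of "R x + R y"] by (simp add: linear_add[OF linA] AR)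
    show "R (c *\<^sub>R x) = c *\<^sub>R R x" for c x
      using RA[of "c *\<^sub>R R x"] by (simp add: linear_scale[OF linA] AR)
    have "norm (R x) \<le> norm x * inverse m" for x
      using m(2)[of "R x", folded A_def] m(1) by (simp add: AR field_simps)
    then show "\<exists>K. \<forall>x. norm (R x) \<le> norm x * K"
      by blast
  qed
  then show ?thesis
    using RA AR by (auto simp: A_def)
qed

section \<open>The Neumann series\<close>

lemma norm_blinfun_pow:
  fixes A :: "'a::real_normed_vector \<Rightarrow>\<^sub>L 'a"
  shows "norm (blinfun_pow A n) \<le> norm A ^ n"
proof (induction n)
  case 0
  show ?case
    by (simp add: norm_blinfun_id_le)
next
  case (Suc n)
  have "norm (A o\<^sub>L blinfun_pow A n) \<le> norm A * norm (blinfun_pow A n)"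
    by (rule norm_blinfun_compose)
  also have "\<dots> \<le> norm A * norm A ^ n"
    using Suc by (simp add: mult_left_mono)
  finally show ?case
    by simp
qed

lemma blinfun_pow_commute:
  fixes A :: "'a::real_normed_vector \<Rightarrow>\<^sub>L 'a"
  shows "blinfun_pow A n (A x) = A (blinfun_pow A n x)"
  by (induction n) auto

lemma blinfun_pow_eigenvector:
  fixes A :: "'a::real_normed_vector \<Rightarrow>\<^sub>L 'a"
  shows "A x = c *\<^sub>R x \<Longrightarrow> blinfun_pow A n x = c ^ n *\<^sub>R x"
  by (induction n) (auto simp: blinfun.scaleR_right mult.commute)

lemma Neumann_series:
  fixes B :: "'a::banach \<Rightarrow>\<^sub>L 'a"
  assumes "norm B < 1"
  obtains N :: "'a \<Rightarrow>\<^sub>L 'a" where "\<And>x. (\<lambda>n. blinfun_pow B n x) sums N x"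
    "\<And>x. N (x - B x) = x" "\<And>x. N x - B (N x) = x"
proof -
  have "summable (\<lambda>n. norm B ^ n)"
    using assms by (simp add: summable_geometric)
  then have "summable (blinfun_pow B)"
    using norm_blinfun_pow by (rule summable_comparison_test'[where N = 0]) 
  define N where "N = suminf (blinfun_pow B)"
  have "blinfun_pow B sums N"
    using \<open>summable (blinfun_pow B)\<close> by (simp add: N_def summable_sums)
  then have sums: "(\<lambda>n. blinfun_pow B n x) sums N x" for x
    using bounded_linear.sums[OF blinfun.bounded_linear_left] by blast
  have shift: "(\<lambda>n. blinfun_pow B (Suc n) x) sums (N x - x)" for x
    using sums_Suc_iff[of "\<lambda>n. blinfun_pow B n x" "N x - x"] sums[of x] by simp
  show thesis
  proof
    show "(\<lambda>n. blinfun_pow B n x) sums N x" for x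
      by (rule sums)
    have "(\<lambda>n. blinfun_pow B n (B x)) sums (N x - x)" for x
      using shift[of x] by (simp add: blinfun_pow_commute)
    then have "N (B x) = N x - x" for x
      using sums sums_unique2 by blast
    then show "N (x - B x) = x" for x
      by (simp add: blinfun.diff_right)
    have "(\<lambda>n. B (blinfun_pow B n x)) sums (N x - x)" for x
      using shift[of x] by simp
    then have "B (N x) = N x - x" for x
      using bounded_linear.sums[OF blinfun.bounded_linear_right sums] sums_unique2 by blast
    then show "N x - B (N x) = x" for x
      by simp
  qed
qed

section \<open>The Hahn--Banach theorem\<close>

definition sublinear :: "('a::real_vector \<Rightarrow> real) \<Rightarrow> bool" where
  "sublinear p \<longleftrightarrow> (\<forall>x y. p (x + y) \<le> p x + p y) \<and> (\<forall>c x. c \<ge> 0 \<longrightarrow> p (c *\<^sub>R x) = c * p x)"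

lemma sublinearD:
  assumes "sublinear p"
  shows "p (x + y) \<le> p x + p y" "c \<ge> 0 \<Longrightarrow> p (c *\<^sub>R x) = c * p x" "p 0 = 0" "- p (- x) \<le> p x"
proof -
  show *: "p (x + y) \<le> p x + p y" "c \<ge> 0 \<Longrightarrow> p (c *\<^sub>R x) = c * p x" for x y c
    using assms by (auto simp: sublinear_def)
  show 0: "p 0 = 0"
    using *(2)[of 0 0] by simp
  show "- p (- x) \<le> p x"
    using *(1)[of x "- x"] 0 by simp
qed

text \<open>The steepest possible descent of \<open>q\<close> in the direction \<open>y\<close>: it remains sublinear, and its value
  at \<open>- y\<close> is at most \<open>- q y\<close>.\<close>

definition tilt :: "('a::real_vector \<Rightarrow> real) \<Rightarrow> 'a \<Rightarrow> 'a \<Rightarrow> real" where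
  "tilt q y x = (INF t\<in>{0..}. q (x + t *\<^sub>R y) - t * q y)"

lemma tilt:
  assumes q: "sublinear q"
  shows "sublinear (tilt q y)" "tilt q y x \<le> q x" "t \<ge> 0 \<Longrightarrow> tilt q y x \<le> q (x + t *\<^sub>R y) - t * q y"
proof -
  have lb: "- q (- x) \<le> q (x + t *\<^sub>R y) - t * q y" if "t \<ge> 0" for x t
    using sublinearD(1)[OF q, of "x + t *\<^sub>R y" "- x"] sublinearD(2)[OF q that, of y] by simp
  have bdd: "bdd_below ((\<lambda>t. q (x + t *\<^sub>R y) - t * q y) ` {0..})" for x
    using lb by (intro bdd_belowI[of _ "- q (- x)"]) auto
  show le: "tilt q y x \<le> q (x + t *\<^sub>R y) - t * q y" if "t \<ge> 0" for x t
    unfolding tilt_def using bdd that by (intro cINF_lower) auto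
  from this[of 0 x] show "tilt q y x \<le> q x"
    by simp
  have greatest: "c \<le> tilt q y x" if "\<And>t. t \<ge> 0 \<Longrightarrow> c \<le> q (x + t *\<^sub>R y) - t * q y" for c x
    unfolding tilt_def using that by (intro cINF_greatest) auto
  have add: "tilt q y (x + z) \<le> tilt q y x + tilt q y z" for x z
  proof -
    have "tilt q y (x + z) - (q (z + s *\<^sub>R y) - s * q y) \<le> tilt q y x" if "s \<ge> 0" for s
    proof (rule greatest)
      fix t :: real assume "t \<ge> 0"
      have "tilt q y (x + z) \<le> q ((x + z) + (t + s) *\<^sub>R y) - (t + s) * q y"
        using le that \<open>t \<ge> 0\<close> by auto
      also have "(x + z) + (t + s) *\<^sub>R y = (x + t *\<^sub>R y) + (z + s *\<^sub>R y)"
        by (simp add: algebra_simps)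
      also have "q \<dots> \<le> q (x + t *\<^sub>R y) + q (z + s *\<^sub>R y)"
        by (rule sublinearD(1)[OF q])
      finally show "tilt q y (x + z) - (q (z + s *\<^sub>R y) - s * q y) \<le> q (x + t *\<^sub>R y) - t * q y"
        by (simp add: algebra_simps)
    qed
    then have "tilt q y (x + z) - tilt q y x \<le> tilt q y z"
      by (intro greatest) (simp add: algebra_simps)
    then show ?thesis
      by simp
  qed
  have scale_le: "tilt q y (c *\<^sub>R x) \<le> c * tilt q y x" if "c > 0" for c x
  proof -
    have "tilt q y (c *\<^sub>R x) / c \<le> tilt q y x"
    proof (rule greatest)
      fix t :: real assume "t \<ge> 0"
      have "tilt q y (c *\<^sub>R x) \<le> q (c *\<^sub>R x + (c * t) *\<^sub>R y) - (c * t) * q y"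
        using le that \<open>t \<ge> 0\<close> by auto
      also have "c *\<^sub>R x + (c * t) *\<^sub>R y = c *\<^sub>R (x + t *\<^sub>R y)"
        by (simp add: algebra_simps)
      also have "q \<dots> = c * q (x + t *\<^sub>R y)"
        using that by (simp add: sublinearD(2)[OF q])
      finally show "tilt q y (c *\<^sub>R x) / c \<le> q (x + t *\<^sub>R y) - t * q y"
        using that by (simp add: field_simps)
    qed
    then show ?thesis
      using that by (simp add: field_simps)
  qed
  have zero: "tilt q y 0 = 0"
  proof (rule antisym)
    show "tilt q y 0 \<le> 0"
      using le[of 0 0] sublinearD(3)[OF q] by simp
    show "0 \<le> tilt q y 0"
      by (rule greatest) (simp add: sublinearD(2)[OF q])
  qed
  have scale: "tilt q y (c *\<^sub>R x) = c * tilt q y x" if "c \<ge> 0" for c x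
  proof (cases "c = 0")
    case False
    then have c: "c > 0"
      using that by simp
    have "tilt q y (inverse c *\<^sub>R (c *\<^sub>R x)) \<le> inverse c * tilt q y (c *\<^sub>R x)"
      using c by (intro scale_le) simp
    then have "c * tilt q y x \<le> tilt q y (c *\<^sub>R x)"
      using c by (simp add: field_simps)
    then show ?thesis
      using scale_le[OF c, of x] by simp
  qed (simp add: zero)
  show "sublinear (tilt q y)"
    using add scale by (simp add: sublinear_def)
qed

lemma sublinear_Inf_chain:
  fixes C :: "('a::real_vector \<Rightarrow> real) set"
  assumes ne: "C \<noteq> {}" and sub: "\<And>q. q \<in> C \<Longrightarrow> sublinear q"
    and chain: "\<And>q r. q \<in> C \<Longrightarrow> r \<in> C \<Longrightarrow> q \<le> r \<or> r \<le> q"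
  shows "sublinear (\<lambda>x. INF q\<in>C. q x)" "q \<in> C \<Longrightarrow> (INF q\<in>C. q x) \<le> q x"
proof -
  obtain p where p: "p \<in> C"
    using ne by blast
  \<comment> \<open>Fix a member \<open>p\<close> of the chain: \<open>- p (- x)\<close> bounds the members below \<open>p\<close>, and \<open>p x\<close> those above.\<close>
  have bdd: "bdd_below ((\<lambda>q. q x) ` C)" for x
  proof (rule bdd_belowI[of _ "min (- p (- x)) (p x)"], clarify)
    fix q assume q: "q \<in> C"
    show "min (- p (- x)) (p x) \<le> q x"
      using chain[OF q p]
    proof
      assume "q \<le> p"
      then have "- p (- x) \<le> - q (- x)"
        by (simp add: le_fun_def)
      then show ?thesis
        using sublinearD(4)[OF sub[OF q], of x] by linarith
    next
      assume "p \<le> q"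
      then have "p x \<le> q x"
        by (simp add: le_fun_def)
      then show ?thesis
        by linarith
    qed
  qed
  show lower: "(INF q\<in>C. q x) \<le> q x" if "q \<in> C" for q x
    using bdd that by (rule cINF_lower)
  show "sublinear (\<lambda>x. INF q\<in>C. q x)"
    unfolding sublinear_def
  proof (intro conjI allI impI)
    fix x y
    have step: "(INF q\<in>C. q (x + y)) \<le> q x + r y" if qr: "q \<in> C" "r \<in> C" for q r
    proof -
      obtain s where s: "s \<in> C" "s \<le> q" "s \<le> r"
        using chain[OF qr] qr by auto
      have "(INF q\<in>C. q (x + y)) \<le> s (x + y)"
        using s by (intro lower)
      also have "\<dots> \<le> s x + s y"
        using sublinearD(1)[OF sub[OF s(1)]] .
      also have "\<dots> \<le> q x + r y"
        using s by (intro add_mono) (auto simp: le_fun_def)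
      finally show ?thesis .
    qed
    have "(INF q\<in>C. q (x + y)) - q x \<le> (INF r\<in>C. r y)" if "q \<in> C" for q
      using step[OF that] ne by (intro cINF_greatest) (auto simp: diff_le_eq add.commute)
    then have "(INF q\<in>C. q (x + y)) - (INF r\<in>C. r y) \<le> (INF q\<in>C. q x)"
      using ne by (intro cINF_greatest) (auto simp: diff_le_eq add.commute)
    then show "(INF q\<in>C. q (x + y)) \<le> (INF q\<in>C. q x) + (INF q\<in>C. q y)"
      by simp
  next
    fix c :: real and x :: 'a
    assume c: "c \<ge> 0"
    have "(INF q\<in>C. q (c *\<^sub>R x)) = (INF q\<in>C. c * q x)"
      using c sub by (intro INF_cong) (auto simp: sublinearD(2))
    also have "\<dots> = c * (INF q\<in>C. q x)"
    proof (cases "c = 0")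
      case False
      have "mono ((*) c)"
        using c by (simp add: mono_def mult_left_mono)
      then show ?thesis
        using continuous_at_Inf_mono[of "(*) c" "(\<lambda>q. q x) ` C"] ne bdd
        by (simp add: image_image continuous_mult_left continuous_ident)
    qed (use ne in simp)
    finally show "(INF q\<in>C. q (c *\<^sub>R x)) = c * (INF q\<in>C. q x)" .
  qed
qed

text \<open>A minimal sublinear functional below \<open>p\<close> coincides with its tilts in all directions, which forces
  additivity. Starting from the tilt of \<open>p\<close> towards \<open>u\<close> prescribes the value at \<open>u\<close>.\<close>

theorem Hahn_Banach_sublinear:
  fixes p :: "'a::real_vector \<Rightarrow> real"
  assumes p: "sublinear p"
  obtains f where "linear f" "\<And>x. f x \<le> p x" "f u = p u"
proof -
  define A where "A = {q. sublinear q \<and> q \<le> tilt p u}"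
  have "\<exists>m\<in>A. \<forall>q\<in>A. m \<ge> q \<longrightarrow> q = m"
  proof (rule predicate_Zorn[where P = "\<lambda>x y. x \<ge> y"])
    show "partial_order_on A (relation_of (\<lambda>x y. y \<le> x) A)"
      by (rule partial_order_on_relation_ofI) auto
  next
    fix C assume "C \<in> Chains (relation_of (\<lambda>x y. y \<le> x) A)"
    then have C: "\<And>q r. q \<in> C \<Longrightarrow> r \<in> C \<Longrightarrow> q \<le> r \<or> r \<le> q" "C \<subseteq> A"
      by (auto simp: Chains_def relation_of_def)
    show "\<exists>m\<in>A. \<forall>q\<in>C. q \<ge> m"
    proof (cases "C = {}")
      case True
      then show ?thesis
        using tilt(1)[OF p, of u] by (auto simp: A_def)
    next
      case False
      have sub: "\<And>q. q \<in> C \<Longrightarrow> sublinear q"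
        using C(2) by (auto simp: A_def)
      note inf = sublinear_Inf_chain[OF False sub C(1)]
      then have lower: "(\<lambda>x. INF q\<in>C. q x) \<le> q" if "q \<in> C" for q
        using that by (simp add: le_fun_def)
      moreover have "(\<lambda>x. INF q\<in>C. q x) \<in> A"
        using inf(1) lower False C(2) unfolding A_def by (blast intro: order_trans)
      ultimately show ?thesis
        by blast
    qed
  qed
  then obtain m where m: "sublinear m" "m \<le> tilt p u"
      and min: "\<And>q. sublinear q \<Longrightarrow> q \<le> m \<Longrightarrow> q = m"
    unfolding A_def by (auto intro: order_trans)
  have add: "m (x + y) = m x + m y" for x y
  proof (rule antisym)
    have "tilt m y = m"
      using tilt[OF m(1)] by (intro min) (auto simp: le_fun_def)
    then show "m x + m y \<le> m (x + y)"
      using tilt(3)[OF m(1), of 1 y x] by simp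
  qed (rule sublinearD(1)[OF m(1)])
  then have neg: "m (- x) = - m x" for x
    by (metis add.right_inverse add_eq_0_iff2 m(1) sublinearD(3))
  have "linear m"
  proof
    show "m (c *\<^sub>R x) = c *\<^sub>R m x" for c x
    proof (cases "c \<ge> 0")
      case True
      then show ?thesis
        using sublinearD(2)[OF m(1)] by simp
    next
      case False
      then show ?thesis
        using sublinearD(2)[OF m(1), of "- c" x] neg[of "c *\<^sub>R x"] by simp
    qed
  qed (rule add)
  have le: "m x \<le> p x" for x
    using m(2) tilt(2)[OF p] by (meson le_fun_def order_trans)
  have "m (- u) \<le> - p u"
    using m(2) tilt(3)[OF p, of 1 u "- u"] sublinearD(3)[OF p] by (auto simp: le_fun_def intro: order_trans)
  then have "m u = p u"
    using le[of u] neg[of u] by simp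
  then show thesis
    using that \<open>linear m\<close> le by blast
qed

section \<open>Positive operators on Banach lattices\<close>

text \<open>Regarding the scalars as a Banach lattice makes positive functionals a special case of positive
  operators.\<close>

instance real :: banach_lattice
  by standard simp

declare abs_ge_self [simp] abs_ge_minus_self [simp]

lemma norm_mono_nonneg:
  fixes x y :: "'a::banach_lattice"
  shows "0 \<le> x \<Longrightarrow> x \<le> y \<Longrightarrow> norm x \<le> norm y"
  by (intro norm_mono_abs) (auto simp: abs_of_nonneg)

lemma norm_abs_lattice [simp]:
  fixes x :: "'a::banach_lattice"
  shows "norm \<bar>x\<bar> = norm x"
  by (intro antisym norm_mono_abs) auto

lemma le_pprt:
  fixes x :: "'a::banach_lattice"
  shows "x \<le> pprt x"
  by (simp add: pprt_def)

lemma pprt_least: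
  fixes x y :: "'a::banach_lattice"
  shows "x \<le> y \<Longrightarrow> 0 \<le> y \<Longrightarrow> pprt x \<le> y"
  by (simp add: pprt_def)

lemma pprt_le_abs:
  fixes x :: "'a::banach_lattice"
  shows "pprt x \<le> \<bar>x\<bar>"
  by (simp add: pprt_least)

lemma pprt_add_le:
  fixes x y :: "'a::banach_lattice"
  shows "pprt (x + y) \<le> pprt x + pprt y"
  by (intro pprt_least add_mono le_pprt) auto

lemma pprt_scaleR_le:
  fixes x :: "'a::banach_lattice"
  assumes "c \<ge> 0"
  shows "pprt (c *\<^sub>R x) \<le> c *\<^sub>R pprt x"
  using assms by (intro pprt_least scaleR_left_mono le_pprt scaleR_nonneg_nonneg) auto

lemma abs_scaleR_le:
  fixes x :: "'a::banach_lattice"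
  shows "\<bar>c *\<^sub>R x\<bar> \<le> \<bar>c\<bar> *\<^sub>R \<bar>x\<bar>"
proof (cases "c \<ge> 0")
  case True
  then show ?thesis
    using scaleR_left_mono[of x "\<bar>x\<bar>" c] scaleR_left_mono[of "- x" "\<bar>x\<bar>" c]
    by (intro abs_leI) auto
next
  case False
  then show ?thesis
    using scaleR_left_mono[of x "\<bar>x\<bar>" "- c"] scaleR_left_mono[of "- x" "\<bar>x\<bar>" "- c"]
    by (intro abs_leI) auto
qed

lemma norm_pprt_diff_le:
  fixes x y :: "'a::banach_lattice"
  shows "norm (pprt x - pprt y) \<le> norm (x - y)"
proof (rule norm_mono_abs, rule abs_leI)
  have "pprt a - pprt b \<le> \<bar>a - b\<bar>" for a b :: 'a
    using pprt_add_le[of "a - b" b] pprt_le_abs[of "a - b"]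
    by (simp add: diff_le_eq) (meson add_right_mono order_trans)
  from this[of x y] this[of y x]
  show "pprt x - pprt y \<le> \<bar>x - y\<bar>" "- (pprt x - pprt y) \<le> \<bar>x - y\<bar>"
    by (auto simp: abs_minus_commute)
qed

lemma continuous_on_pprt [continuous_intros]:
  fixes f :: "'b::topological_space \<Rightarrow> 'a::banach_lattice"
  assumes "continuous_on S f"
  shows "continuous_on S (\<lambda>x. pprt (f x))"
proof -
  have "1-lipschitz_on UNIV (pprt :: 'a \<Rightarrow> 'a)"
    using norm_pprt_diff_le by (intro lipschitz_onI) (auto simp: dist_norm)
  then show ?thesis
    using continuous_on_compose2[OF lipschitz_on_continuous_on assms] by blast
qed

lemma closed_nonneg_cone: "closed {x :: 'a::banach_lattice. 0 \<le> x}"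
proof -
  have "{x :: 'a. 0 \<le> x} = {x. pprt (- x) = 0}"
    by (simp flip: le_zero_iff_zero_pprt)
  moreover have "closed {x :: 'a. pprt (- x) = 0}"
    by (intro closed_Collect_eq continuous_intros)
  ultimately show ?thesis
    by simp
qed

lemma positive_op_mono:
  fixes A :: "'a::banach_lattice \<Rightarrow>\<^sub>L 'b::banach_lattice"
  assumes "positive_op A" "x \<le> y"
  shows "A x \<le> A y"
  using assms unfolding positive_op_def by (metis blinfun.diff_right diff_ge_0_iff_ge)

lemma positive_op_abs:
  fixes A :: "'a::banach_lattice \<Rightarrow>\<^sub>L 'b::banach_lattice"
  assumes "positive_op A"
  shows "\<bar>A x\<bar> \<le> A \<bar>x\<bar>"
  using positive_op_mono[OF assms, of x "\<bar>x\<bar>"] positive_op_mono[OF assms, of "- x" "\<bar>x\<bar>"]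
  by (intro abs_leI) (auto simp: blinfun.minus_right)

lemma norm_positive_op_abs:
  fixes A :: "'a::banach_lattice \<Rightarrow>\<^sub>L 'b::banach_lattice"
  assumes "positive_op A"
  shows "norm (A x) \<le> norm (A \<bar>x\<bar>)"
  using positive_op_abs[OF assms, of x]
  by (intro norm_mono_abs) (auto intro: order_trans)

lemma norm_positive_op_bound:
  fixes A :: "'a::banach_lattice \<Rightarrow>\<^sub>L 'b::banach_lattice"
  assumes "positive_op A" "b \<ge> 0" "\<And>x. 0 \<le> x \<Longrightarrow> norm (A x) \<le> b * norm x"
  shows "norm A \<le> b"
proof (rule norm_blinfun_bound[OF assms(2)])
  show "norm (A x) \<le> b * norm x" for x
    using norm_positive_op_abs[OF assms(1), of x] assms(3)[of "\<bar>x\<bar>"] by simp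
qed

lemma positive_op_compose:
  "positive_op A \<Longrightarrow> positive_op B \<Longrightarrow> positive_op (A o\<^sub>L B)"
  by (simp add: positive_op_def)

lemma positive_op_Neumann_series:
  fixes B :: "'a::banach_lattice \<Rightarrow>\<^sub>L 'a"
  assumes "positive_op B" "norm B < 1"
  obtains N :: "'a \<Rightarrow>\<^sub>L 'a" where "positive_op N" "\<And>x. N (x - B x) = x" "\<And>x. N x - B (N x) = x"
proof -
  obtain N :: "'a \<Rightarrow>\<^sub>L 'a" where N: "\<And>x. (\<lambda>n. blinfun_pow B n x) sums N x"
      "\<And>x. N (x - B x) = x" "\<And>x. N x - B (N x) = x"
    using Neumann_series[OF assms(2)] by blast
  have pow: "0 \<le> blinfun_pow B n x" if "0 \<le> x" for n x
    using assms(1) that by (induction n) (auto simp: positive_op_def)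
  have "0 \<le> N x" if "0 \<le> x" for x
  proof -
    have "(\<Sum>i<n. blinfun_pow B i x) \<in> {x. 0 \<le> x}" for n
      using pow[OF that] by (simp add: sum_nonneg)
    then have "N x \<in> {x. 0 \<le> x}"
      using N(1)[of x] unfolding sums_def by (rule closed_sequentially[OF closed_nonneg_cone])
    then show ?thesis
      by simp
  qed
  then have "positive_op N"
    by (simp add: positive_op_def)
  then show thesis
    using N(2,3) by (rule that)
qed

definition positive_resolvent ::
    "('a::banach_lattice \<Rightarrow>\<^sub>L 'a) \<Rightarrow> real \<Rightarrow> ('a \<Rightarrow>\<^sub>L 'a) \<Rightarrow> bool" where
  "positive_resolvent A t R \<longleftrightarrow> positive_op R \<and>
     (\<forall>x. R (t *\<^sub>R x - A x) = x) \<and> (\<forall>x. t *\<^sub>R R x - A (R x) = x)"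

lemma positive_resolventD:
  assumes "positive_resolvent A t R"
  shows "positive_op R" "A (R x) = t *\<^sub>R R x - x" "R (A x) = t *\<^sub>R R x - x"
proof -
  have R: "positive_op R" "\<And>x. R (t *\<^sub>R x - A x) = x" "\<And>x. t *\<^sub>R R x - A (R x) = x"
    using assms by (auto simp: positive_resolvent_def)
  show "positive_op R"
    by fact
  show "A (R x) = t *\<^sub>R R x - x" "R (A x) = t *\<^sub>R R x - x"
    using R(2,3)[of x] by (auto simp: blinfun.diff_right blinfun.scaleR_right algebra_simps)
qed

lemma positive_resolvent_exists:
  fixes A :: "'a::banach_lattice \<Rightarrow>\<^sub>L 'a"
  assumes "positive_op A" "norm A < t"
  obtains R where "positive_resolvent A t R"
proof -
  have t: "t > 0"
    using assms(2) norm_ge_zero[of A] by linarith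
  have "positive_op (A /\<^sub>R t)"
    using assms(1) t by (simp add: positive_op_def blinfun.scaleR_left scaleR_nonneg_nonneg)
  moreover have "norm (A /\<^sub>R t) < 1"
    using assms(2) t by (simp add: field_simps)
  ultimately obtain N :: "'a \<Rightarrow>\<^sub>L 'a" where N: "positive_op N"
      "\<And>x. N (x - (A /\<^sub>R t) x) = x" "\<And>x. N x - (A /\<^sub>R t) (N x) = x"
    using positive_op_Neumann_series by blast
  have "positive_resolvent A t (N /\<^sub>R t)"
    unfolding positive_resolvent_def
  proof (intro conjI allI)
    show "positive_op (N /\<^sub>R t)"
      using N(1) t by (simp add: positive_op_def blinfun.scaleR_left scaleR_nonneg_nonneg)
    fix x
    have "t *\<^sub>R x - A x = t *\<^sub>R (x - (A /\<^sub>R t) x)"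
      using t by (simp add: scaleR_diff_right blinfun.scaleR_left)
    then show "(N /\<^sub>R t) (t *\<^sub>R x - A x) = x"
      using t N(2)[of x] by (simp add: blinfun.scaleR_left blinfun.scaleR_right)
    show "t *\<^sub>R (N /\<^sub>R t) x - A ((N /\<^sub>R t) x) = x"
      using t N(3)[of x] by (simp add: blinfun.scaleR_left blinfun.scaleR_right)
  qed
  then show thesis
    using that by blast
qed

text \<open>The resolvent at \<open>t - d\<close> is \<open>R (I - d R)\<^sup>-\<^sup>1\<close>, and the Neumann series of the second factor has
  positive terms.\<close>

lemma positive_resolvent_decrease:
  fixes A :: "'a::banach_lattice \<Rightarrow>\<^sub>L 'a"
  assumes R: "positive_resolvent A t R" and d: "d \<ge> 0" "d * norm R < 1"
  obtains R' where "positive_resolvent A (t - d) R'"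
proof -
  have "positive_op (d *\<^sub>R R)" "norm (d *\<^sub>R R) < 1"
    using positive_resolventD(1)[OF R] d
    by (simp_all add: positive_op_def blinfun.scaleR_left scaleR_nonneg_nonneg)
  then obtain N :: "'a \<Rightarrow>\<^sub>L 'a" where N: "positive_op N"
      "\<And>x. N (x - (d *\<^sub>R R) x) = x" "\<And>x. N x - (d *\<^sub>R R) (N x) = x"
    using positive_op_Neumann_series by blast
  have left: "N (R ((t - d) *\<^sub>R x - A x)) = x" for x
  proof -
    have "R ((t - d) *\<^sub>R x - A x) = x - (d *\<^sub>R R) x"
      by (simp add: positive_resolventD(3)[OF R] blinfun.diff_right blinfun.scaleR_right
          blinfun.scaleR_left scaleR_diff_left)
    then show ?thesis
      by (simp add: N(2))
  qed
  have right: "(t - d) *\<^sub>R R (N x) - A (R (N x)) = x" for x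
    using N(3)[of x] by (simp add: positive_resolventD(2)[OF R] blinfun.scaleR_left algebra_simps)
  have "N (R x) = R (N x)" for x
    using left[of "R (N x)"] right[of x] by simp
  then have "positive_resolvent A (t - d) (N o\<^sub>L R)"
    using left right N(1) positive_resolventD(1)[OF R]
    by (simp add: positive_resolvent_def positive_op_compose)
  then show thesis
    using that by blast
qed

text \<open>These are the terms of the expansion of \<open>R\<close> in powers of \<open>A / t\<close>. The bound also holds at those \<open>t\<close>
  for which that series is not known to converge, because it only iterates \<open>t R = I + A R\<close>.\<close>

lemma blinfun_pow_le_positive_resolvent:
  fixes A :: "'a::banach_lattice \<Rightarrow>\<^sub>L 'a"
  assumes A: "positive_op A" and R: "positive_resolvent A t R" and "t > 0" and x: "x \<ge> 0"
  shows "blinfun_pow A n x \<le> t ^ Suc n *\<^sub>R R x"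
proof (induction n)
  case 0
  have "0 \<le> A (R x)"
    using A x positive_resolventD(1)[OF R] by (auto simp: positive_op_def)
  then show ?case
    by (simp add: positive_resolventD(2)[OF R])
next
  case (Suc n)
  have "blinfun_pow A (Suc n) x \<le> A (t ^ Suc n *\<^sub>R R x)"
    using positive_op_mono[OF A Suc] by simp
  also have "\<dots> = t ^ Suc (Suc n) *\<^sub>R R x - t ^ Suc n *\<^sub>R x"
    by (simp add: positive_resolventD(2)[OF R] blinfun.scaleR_right scaleR_diff_right ac_simps
        del: power_Suc) simp
  also have "\<dots> \<le> t ^ Suc (Suc n) *\<^sub>R R x"
    using x \<open>t > 0\<close> by (simp add: scaleR_nonneg_nonneg)
  finally show ?case .
qed

section \<open>The Krein--Rutman theorem\<close>

text \<open>As \<open>t\<close> decreases to \<open>q\<close>, normalised values of the resolvent at positive vectors are approximate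
  eigenvectors; compactness makes a subsequence converge.\<close>

lemma positive_eigenvector_of_resolvent_blowup:
  fixes A :: "'a::banach_lattice \<Rightarrow>\<^sub>L 'a"
  assumes A: "compact_op A" and q: "q > 0"
    and R: "\<And>n. positive_resolvent A (t n) (R n)"
    and t: "t \<longlonglongrightarrow> q" and blowup: "\<And>n. real (Suc n) \<le> norm (R n)"
  obtains x where "x > 0" "A x = q *\<^sub>R x"
proof -
  have pos: "norm (R n) > 0" for n
    using blowup[of n] by linarith
  have "\<exists>x\<ge>0. norm (R n) / 2 * norm x < norm (R n x)" for n
  proof (rule ccontr)
    assume "\<not> ?thesis"
    then have "norm (R n) \<le> norm (R n) / 2"
      using pos[of n] by (intro norm_positive_op_bound positive_resolventD(1)[OF R])
        (auto simp: not_less)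
    then show False
      using pos[of n] by simp
  qed
  then obtain x where x: "\<And>n. x n \<ge> 0" "\<And>n. norm (R n) / 2 * norm (x n) < norm (R n (x n))"
    by metis
  define c where "c n = norm (R n (x n))" for n
  have c: "c n > 0" for n
    unfolding c_def by (rule le_less_trans[OF _ x(2)]) simp
  define y where "y n = x n /\<^sub>R c n" for n
  define z where "z n = R n (y n)" for n
  have z: "z n \<ge> 0" "norm (z n) = 1" for n
  proof -
    have "y n \<ge> 0"
      using x c[of n] by (simp add: y_def scaleR_nonneg_nonneg)
    then show "z n \<ge> 0"
      using positive_resolventD(1)[OF R] by (auto simp: z_def positive_op_def)
    show "norm (z n) = 1"
      using c[of n] by (simp add: z_def y_def blinfun.scaleR_right flip: c_def)
  qed
  have "norm (y n) \<le> 2 * inverse (real (Suc n))" for n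
  proof -
    have "real (Suc n) / 2 * norm (x n) \<le> norm (R n) / 2 * norm (x n)"
      using blowup[of n] by (intro mult_right_mono) auto
    also have "\<dots> < c n"
      using x(2)[of n] by (simp add: c_def)
    finally show ?thesis
      using c[of n] by (simp add: y_def field_simps)
  qed
  moreover have "(\<lambda>n. 2 * inverse (real (Suc n))) \<longlonglongrightarrow> 0"
    by (intro tendsto_mult_right_zero LIMSEQ_inverse_real_of_nat)
  ultimately have y0: "y \<longlonglongrightarrow> 0"
    by (rule Lim_null_comparison[OF always_eventually[OF allI]])
  obtain l r where r: "strict_mono (r :: nat \<Rightarrow> nat)" and l: "(\<lambda>n. A (z (r n))) \<longlonglongrightarrow> l"
    using compact_op_subsequence[OF A, of z 1] z(2) by (metis order_refl)
  have yr: "(\<lambda>n. y (r n)) \<longlonglongrightarrow> 0" and tr: "(\<lambda>n. t (r n)) \<longlonglongrightarrow> q"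
    using LIMSEQ_subseq_LIMSEQ[OF y0 r] LIMSEQ_subseq_LIMSEQ[OF t r] by (simp_all add: o_def)
  have "(\<lambda>n. inverse (t (r n)) *\<^sub>R (A (z (r n)) + y (r n))) \<longlonglongrightarrow> inverse q *\<^sub>R (l + 0)"
    using q by (intro tendsto_intros l yr tr) auto
  moreover have "\<forall>\<^sub>F n in sequentially. t (r n) > 0"
    using order_tendstoD(1)[OF tr q] .
  then have "\<forall>\<^sub>F n in sequentially. inverse (t (r n)) *\<^sub>R (A (z (r n)) + y (r n)) = z (r n)"
    by (rule eventually_mono) (simp add: z_def positive_resolventD(2)[OF R])
  ultimately have zr: "(\<lambda>n. z (r n)) \<longlonglongrightarrow> inverse q *\<^sub>R l"
    by (simp add: tendsto_cong)
  have "(\<lambda>n. A (z (r n))) \<longlonglongrightarrow> A (inverse q *\<^sub>R l)"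
    by (intro tendsto_intros zr)
  then have "l = A (inverse q *\<^sub>R l)"
    using l LIMSEQ_unique by blast
  then have "A (inverse q *\<^sub>R l) = q *\<^sub>R (inverse q *\<^sub>R l)"
    using q by simp
  moreover have "inverse q *\<^sub>R l \<in> {x. 0 \<le> x}"
    using z(1) closed_sequentially[OF closed_nonneg_cone _ zr] by simp
  moreover have "norm (inverse q *\<^sub>R l) = 1"
    using tendsto_norm[OF zr] z(2) by (simp add: LIMSEQ_const_iff)
  then have "inverse q *\<^sub>R l \<noteq> 0"
    by force
  ultimately show thesis
    using that[of "inverse q *\<^sub>R l"] by (simp add: order_less_le)
qed

text \<open>The sublinear functional \<open>p x = inf\<^sub>v \<parallel>(x + (q - A) v)\<^sup>+\<parallel>\<close> measures how far \<open>x\<close> is from being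
  dominated by the range of \<open>q - A\<close>, so that any linear functional below \<open>p\<close> is positive and vanishes
  on that range. The point is that \<open>p\<close> does not vanish identically: otherwise, by compactness, every
  \<open>A x\<close> with \<open>\<parallel>x\<parallel> \<le> 1\<close> would be dominated up to a small error by some \<open>(q - A) v\<close> with \<open>v\<close> from a
  fixed finite set, and the resolvents would remain bounded as \<open>t\<close> decreases to \<open>q\<close>.\<close>

lemma positive_eigenfunctional_of_resolvent_blowup:
  fixes A :: "'a::banach_lattice \<Rightarrow>\<^sub>L 'a"
  assumes A: "compact_op A" "positive_op A" and q: "q > 0"
    and R: "\<And>d. d > 0 \<Longrightarrow> \<exists>t R. q < t \<and> t < q + d \<and> positive_resolvent A t R \<and> 1 \<le> (t - q) * norm R"
  obtains f :: "'a \<Rightarrow>\<^sub>L real" where "positive_op f" "f \<noteq> 0" "\<And>x. f (A x) = q * f x"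
proof -
  define W where "W v = q *\<^sub>R v - A v" for v
  have W_add: "W (v + w) = W v + W w" and W_scale: "W (c *\<^sub>R v) = c *\<^sub>R W v"
    and W_minus: "W (- v) = - W v" for v w c
    by (simp_all add: W_def blinfun.add_right blinfun.scaleR_right blinfun.minus_right algebra_simps)
  define p where "p x = (INF v. norm (pprt (x + W v)))" for x
  have bdd: "bdd_below (range (\<lambda>v. norm (pprt (x + W v))))" for x
    by (rule bdd_belowI[of _ 0]) auto
  have p_le: "p x \<le> norm (pprt (x + W v))" for x v
    unfolding p_def using bdd by (rule cINF_lower) simp
  have p_ge: "c \<le> p x" if "\<And>v. c \<le> norm (pprt (x + W v))" for c x
    unfolding p_def using that by (intro cINF_greatest) auto
  have p_add: "p (x + y) \<le> p x + p y" for x y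
  proof -
    have "p (x + y) \<le> norm (pprt (x + W v)) + norm (pprt (y + W w))" for v w
    proof -
      have "p (x + y) \<le> norm (pprt ((x + W v) + (y + W w)))"
        using p_le[of "x + y" "v + w"] by (simp add: W_add algebra_simps)
      also have "\<dots> \<le> norm (pprt (x + W v) + pprt (y + W w))"
        by (intro norm_mono_nonneg pprt_add_le) simp
      finally show ?thesis
        using norm_triangle_ineq order_trans by blast
    qed
    then have "p (x + y) - norm (pprt (x + W v)) \<le> p y" for v
      by (intro p_ge) (simp add: diff_le_eq add.commute)
    then have "p (x + y) - p y \<le> p x"
      by (intro p_ge) (simp add: diff_le_eq add.commute)
    then show ?thesis
      by simp
  qed
  have p_scale_le: "p (c *\<^sub>R x) \<le> c * p x" if "c > 0" for c x
  proof -
    have "p (c *\<^sub>R x) / c \<le> norm (pprt (x + W v))" for v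
    proof -
      have "p (c *\<^sub>R x) \<le> norm (pprt (c *\<^sub>R (x + W v)))"
        using p_le[of "c *\<^sub>R x" "c *\<^sub>R v"] by (simp add: W_scale scaleR_add_right)
      also have "\<dots> \<le> norm (c *\<^sub>R pprt (x + W v))"
        using that by (intro norm_mono_nonneg pprt_scaleR_le) auto
      finally show ?thesis
        using that by (simp add: field_simps)
    qed
    then have "p (c *\<^sub>R x) / c \<le> p x"
      by (rule p_ge)
    then show ?thesis
      using that by (simp add: field_simps)
  qed
  have p_nonneg: "p x \<ge> 0" for x
    by (rule p_ge) simp
  have p_scale: "p (c *\<^sub>R x) = c * p x" if "c \<ge> 0" for c x
  proof (cases "c = 0")
    case True
    then show ?thesis
      using p_le[of 0 0] p_nonneg[of 0] by (simp add: W_def)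
  next
    case False
    then have c: "c > 0"
      using that by simp
    have "p (inverse c *\<^sub>R (c *\<^sub>R x)) \<le> inverse c * p (c *\<^sub>R x)"
      using c by (intro p_scale_le) simp
    then have "c * p x \<le> p (c *\<^sub>R x)"
      using c by (simp add: field_simps)
    then show ?thesis
      using p_scale_le[OF c, of x] by simp
  qed
  have "sublinear p"
    using p_add p_scale by (simp add: sublinear_def)
  have "\<exists>u. p u > 0"
  proof (rule ccontr)
    assume "\<nexists>u. p u > 0"
    then have p0: "p u < q / 4" for u
      using q by (metis divide_pos_pos not_less order_le_less_trans zero_less_numeral)
    define U where "U v = {u. norm (pprt (u + W v)) < q / 4}" for v
    have cover: "u \<in> \<Union> (range U)" for u
    proof -
      have "\<exists>v. norm (pprt (u + W v)) < q / 4"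
        using p0[of u] cINF_less_iff[OF _ bdd, of u "q / 4"] unfolding p_def by simp
      then show ?thesis
        by (auto simp: U_def)
    qed
    have "compact (closure (A ` cball 0 1))"
      using A(1) by (simp add: compact_op_def)
    moreover have "open (U v)" if "v \<in> UNIV" for v
      unfolding U_def by (intro open_Collect_less continuous_intros)
    moreover have "closure (A ` cball 0 1) \<subseteq> (\<Union>v. U v)"
      using cover by blast
    ultimately obtain D where D: "finite D" "closure (A ` cball 0 1) \<subseteq> (\<Union>v\<in>D. U v)"
      by (rule compactE_image[of "closure (A ` cball 0 1)" UNIV U])
    obtain V where V: "V \<ge> 0" "\<And>v. v \<in> D \<Longrightarrow> norm v \<le> V"
      using finite_imp_bounded[OF D(1)] by (auto simp: bounded_pos intro: less_imp_le)
    define d where "d = q / (4 * (V + 1))"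
    have "d > 0"
      using q V by (simp add: d_def)
    then obtain t R where t: "q < t" "t < q + d" and R: "positive_resolvent A t R"
        and blowup: "1 \<le> (t - q) * norm R"
      using R by blast
    define M where "M = norm R"
    have M: "M \<ge> 0"
      by (simp add: M_def)
    define b where "b = 1 + (V + (t - q) * M * V + M * (q / 4))"
    have b: "b \<ge> 0"
      using V M t q by (simp add: b_def)
    have bound: "t * norm (R x) \<le> b" if x: "0 \<le> x" "norm x = 1" for x
    proof -
      have "A x \<in> closure (A ` cball 0 1)"
        using x closure_subset[of "A ` cball 0 1"] by auto
      then obtain v where v: "v \<in> D" "norm (pprt (A x + W v)) < q / 4"
        using D(2) by (auto simp: U_def)
      let ?e = "pprt (A x + W v)"
      have RW: "R (W v) = v - (t - q) *\<^sub>R R v"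
        by (simp add: W_def blinfun.diff_right blinfun.scaleR_right positive_resolventD(3)[OF R]
            scaleR_diff_left)
      have "A x \<le> ?e - W v"
        using le_pprt[of "A x + W v"] by (simp add: le_diff_eq)
      then have "R (A x) \<le> R (?e - W v)"
        by (intro positive_op_mono[OF positive_resolventD(1)[OF R]])
      also have "\<dots> = R ?e - v + (t - q) *\<^sub>R R v"
        by (simp add: RW blinfun.diff_right)
      finally have "norm (R (A x)) \<le> norm (R ?e - v + (t - q) *\<^sub>R R v)"
        using A(2) x positive_resolventD(1)[OF R] by (intro norm_mono_nonneg) (auto simp: positive_op_def)
      also have "\<dots> \<le> norm (R ?e) + norm v + norm ((t - q) *\<^sub>R R v)"
        by (meson add_right_mono norm_triangle_ineq norm_triangle_ineq4 order_trans)
      finally have split: "norm (R (A x)) \<le> norm (R ?e) + norm v + norm ((t - q) *\<^sub>R R v)" .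
      have "norm (R ?e) \<le> M * norm ?e"
        unfolding M_def by (rule norm_blinfun)
      also have "\<dots> \<le> M * (q / 4)"
        using v(2) M by (intro mult_left_mono) auto
      finally have 1: "norm (R ?e) \<le> M * (q / 4)" .
      have "norm (R v) \<le> M * norm v"
        unfolding M_def by (rule norm_blinfun)
      also have "\<dots> \<le> M * V"
        using V(2)[OF v(1)] M by (intro mult_left_mono) auto
      finally have 2: "norm ((t - q) *\<^sub>R R v) \<le> (t - q) * (M * V)"
        using t by (simp add: mult_left_mono)
      have *: "norm (R (A x)) \<le> M * (q / 4) + V + (t - q) * (M * V)"
        using split 1 2 V(2)[OF v(1)] by linarith
      have "t * norm (R x) = norm (x + R (A x))"
        using t q by (simp add: positive_resolventD(3)[OF R])
      also have "\<dots> \<le> 1 + norm (R (A x))"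
        using norm_triangle_ineq[of x "R (A x)"] x by simp
      finally show ?thesis
        using * by (simp add: b_def mult.assoc)
    qed
    have "norm R \<le> b / t"
    proof (rule norm_positive_op_bound[OF positive_resolventD(1)[OF R]])
      show "b / t \<ge> 0"
        using b t q by simp
      fix x :: 'a assume x: "0 \<le> x"
      show "norm (R x) \<le> b / t * norm x"
      proof (cases "x = 0")
        case False
        have "t * norm (R (x /\<^sub>R norm x)) \<le> b"
          using x False by (intro bound) (auto intro: scaleR_nonneg_nonneg)
        then show ?thesis
          using False t q by (simp add: blinfun.scaleR_right field_simps)
      qed simp
    qed
    then have "t * M \<le> b"
      using t q by (simp add: M_def field_simps)
    moreover have "q * M \<le> t * M"
      using t M by (intro mult_right_mono) auto
    moreover have dV: "d * (4 * (V + 1)) = q"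
      using V by (simp add: d_def)
    moreover have "(t - q) * V \<le> q / 4"
    proof -
      have "(t - q) * V \<le> d * (V + 1)"
        using t V by (intro mult_mono) auto
      then show ?thesis
        using dV by (simp add: algebra_simps)
    qed
    then have "(t - q) * M * V \<le> q / 4 * M"
      using M by (metis mult.assoc mult.commute mult_right_mono)
    ultimately have qM: "q * M \<le> 2 * (V + 1)"
      by (simp add: b_def algebra_simps)
    have "1 \<le> (t - q) * M"
      using blowup by (simp add: M_def)
    also have "\<dots> \<le> d * M"
      using t M by (intro mult_right_mono) auto
    finally have "4 * (V + 1) * 1 \<le> 4 * (V + 1) * (d * M)"
      using V by (intro mult_left_mono) auto
    also have "\<dots> = q * M"
      unfolding dV[symmetric] by (simp only: ac_simps)
    finally have "4 * (V + 1) \<le> q * M"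
      by simp
    then show False
      using qM V by simp
  qed
  then obtain u where u: "p u > 0"
    by blast
  obtain g where g: "linear g" "\<And>x. g x \<le> p x" "g u = p u"
    using Hahn_Banach_sublinear[OF \<open>sublinear p\<close>] by blast
  have g_le: "g x \<le> norm (pprt x)" for x
    using g(2)[of x] p_le[of x 0] by (simp add: W_def)
  have "norm (g x) \<le> norm x * 1" for x
  proof -
    have "g y \<le> norm y" for y
    proof -
      have "norm (pprt y) \<le> norm \<bar>y\<bar>"
        by (intro norm_mono_nonneg pprt_le_abs) simp
      then show ?thesis
        using g_le[of y] by simp
    qed
    from this[of x] this[of "- x"] show ?thesis
      by (simp add: linear_neg[OF g(1)])
  qed
  then have "bounded_linear g"
    using g(1) by (intro bounded_linear.intro bounded_linear_axioms.intro) blast+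
  then have G: "Blinfun g x = g x" for x
    by (simp add: bounded_linear_Blinfun_apply)
  show thesis
  proof
    show "positive_op (Blinfun g)"
      unfolding positive_op_def G
    proof (intro allI impI)
      show "0 \<le> g x" if "0 \<le> x" for x
        using g_le[of "- x"] that by (simp add: linear_neg[OF g(1)])
    qed
    show "Blinfun g \<noteq> 0"
      using u g(3) G by (metis order_less_irrefl zero_blinfun.rep_eq)
    fix x
    have "g (W v) \<le> 0" for v
      using g(2)[of "W v"] p_le[of "W v" "- v"] by (simp add: W_minus)
    from this[of x] this[of "- x"] have "g (W x) = 0"
      by (simp add: W_minus linear_neg[OF g(1)])
    then show "Blinfun g (A x) = q * Blinfun g x"
      by (simp add: G W_def linear_diff[OF g(1)] linear_scale[OF g(1)])
  qed
qed

text \<open>The eigenvalue is the infimum of all \<open>t > 0\<close> at which \<open>A\<close> has a positive resolvent. It is positive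
  because the powers of \<open>A\<close> do not decay faster than geometrically, and the resolvents blow up there
  because a positive resolvent at \<open>t\<close> produces positive resolvents at slightly smaller arguments.\<close>

theorem Krein_Rutman:
  fixes A :: "'a::banach_lattice \<Rightarrow>\<^sub>L 'a"
  assumes A: "compact_op A" "positive_op A"
    and growth: "x0 \<ge> 0" "a > 0" "e > 0" "\<And>n. e * a ^ n \<le> norm (blinfun_pow A n x0)"
  obtains q x and f :: "'a \<Rightarrow>\<^sub>L real" where "q > 0" "x > 0" "A x = q *\<^sub>R x"
    "positive_op f" "f \<noteq> 0" "\<And>x. f (A x) = q * f x"
proof -
  define P where "P = {t. t > 0 \<and> (\<exists>R. positive_resolvent A t R)}"
  have "norm A + 1 \<in> P"
    using positive_resolvent_exists[OF A(2), of "norm A + 1"] by (auto simp: P_def add_nonneg_pos)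
  then have ne: "P \<noteq> {}"
    by blast
  have lb: "a \<le> t" if tP: "t \<in> P" for t
  proof (rule ccontr)
    assume "\<not> a \<le> t"
    obtain R where t: "t > 0" and R: "positive_resolvent A t R"
      using tP by (auto simp: P_def)
    have le: "e \<le> (t / a) ^ n * (t * norm (R x0))" for n
    proof -
      have "0 \<le> blinfun_pow A n x0"
        using A(2) growth(1) by (induction n) (auto simp: positive_op_def)
      then have "norm (blinfun_pow A n x0) \<le> norm (t ^ Suc n *\<^sub>R R x0)"
        by (intro norm_mono_nonneg blinfun_pow_le_positive_resolvent[OF A(2) R t growth(1)])
      then have "e * a ^ n \<le> t ^ Suc n * norm (R x0)"
        using growth(4)[of n] t by simp
      then show ?thesis
        using growth(2) by (simp add: field_simps)
    qed
    have "(\<lambda>n. (t / a) ^ n * (t * norm (R x0))) \<longlonglongrightarrow> 0 * (t * norm (R x0))"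
      using t \<open>\<not> a \<le> t\<close> growth(2) by (intro tendsto_intros LIMSEQ_power_zero) auto
    then have "e \<le> 0"
      using le by (intro LIMSEQ_le_const[of _ 0 e]) auto
    then show False
      using growth(3) by simp
  qed
  define q where "q = Inf P"
  have bdd: "bdd_below P"
    using lb by (auto simp: bdd_below_def)
  have q: "q > 0"
    using cInf_greatest[OF ne lb] growth(2) by (simp add: q_def)
  have blowup: "1 \<le> (t - q) * norm R" if tR: "t > 0" "positive_resolvent A t R" for t R
  proof (rule ccontr)
    assume lt: "\<not> ?thesis"
    have "q \<le> t"
      using tR bdd by (auto simp: q_def P_def intro!: cInf_lower)
    have "\<exists>d > t - q. d < t \<and> d * norm R < 1"
    proof (cases "norm R = 0")
      case True
      then show ?thesis
        using q dense[of "t - q" t] by auto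
    next
      case False
      then have "t - q < min t (1 / norm R)"
        using lt q by (simp add: field_simps)
      then obtain d where "t - q < d" "d < min t (1 / norm R)"
        using dense by blast
      then show ?thesis
        using False by (auto simp: field_simps)
    qed
    then obtain d where d: "d > t - q" "d < t" "d * norm R < 1"
      by blast
    then obtain R' where "positive_resolvent A (t - d) R'"
      using positive_resolvent_decrease[OF tR(2), of d] \<open>q \<le> t\<close> by auto
    then have "t - d \<in> P"
      using d by (auto simp: P_def)
    then have "q \<le> t - d"
      unfolding q_def using bdd by (rule cInf_lower)
    then show False
      using d by simp
  qed
  \<comment> \<open>By \<open>blowup\<close> the infimum is not attained.\<close>
  have approx: "\<exists>t R. q < t \<and> t < q + d \<and> positive_resolvent A t R \<and> 1 \<le> (t - q) * norm R"
    if d: "d > 0" for d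
  proof -
    obtain t where "t \<in> P" "t < q + d"
      using cInf_lessD[OF ne, of "q + d"] d by (auto simp: q_def)
    then obtain R where "positive_resolvent A t R" "t > 0" "1 \<le> (t - q) * norm R"
      using blowup by (auto simp: P_def)
    moreover from this have "q < t"
      using mult_nonpos_nonneg[of "t - q" "norm R"] by fastforce
    ultimately show ?thesis
      using \<open>t < q + d\<close> by blast
  qed
  obtain f :: "'a \<Rightarrow>\<^sub>L real" where f: "positive_op f" "f \<noteq> 0" "\<And>x. f (A x) = q * f x"
    using positive_eigenfunctional_of_resolvent_blowup[OF A q approx] by blast
  have "\<exists>t R. q < t \<and> t < q + inverse (real (Suc n)) \<and> positive_resolvent A t R
      \<and> 1 \<le> (t - q) * norm R" for n
    by (rule approx) simp
  then obtain t R where tR: "\<And>n. q < t n" "\<And>n. t n < q + inverse (real (Suc n))"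
      "\<And>n. positive_resolvent A (t n) (R n)" "\<And>n. 1 \<le> (t n - q) * norm (R n)"
    by metis
  have "t \<longlonglongrightarrow> q"
  proof (rule tendsto_sandwich[OF always_eventually always_eventually tendsto_const])
    show "\<forall>n. q \<le> t n" "\<forall>n. t n \<le> q + inverse (real (Suc n))"
      using tR(1,2) by (auto intro: less_imp_le simp del: of_nat_Suc)
    show "(\<lambda>n. q + inverse (real (Suc n))) \<longlonglongrightarrow> q"
      using tendsto_add[OF tendsto_const LIMSEQ_inverse_real_of_nat, of q] by simp
  qed
  moreover have "real (Suc n) \<le> norm (R n)" for n
  proof -
    have "(t n - q) * norm (R n) \<le> inverse (real (Suc n)) * norm (R n)"
      using tR(2)[of n] by (intro mult_right_mono) auto
    then have "1 \<le> inverse (real (Suc n)) * norm (R n)"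
      using tR(4)[of n] by linarith
    then show ?thesis
      by (simp add: field_simps)
  qed
  ultimately obtain x where "x > 0" "A x = q *\<^sub>R x"
    by (rule positive_eigenvector_of_resolvent_blowup[OF A(1) q tR(3)])
  then show thesis
    using that q f by blast
qed

section \<open>Ideal irreducible operators\<close>

definition ideal_irreducible :: "('a::banach_lattice \<Rightarrow>\<^sub>L 'a) \<Rightarrow> bool" where
  "ideal_irreducible T \<longleftrightarrow> \<not> (\<exists>J. nontrivial_closed_ideal J \<and> invariant_under T J)"

text \<open>The closure of the principal ideal of \<open>v \<ge> 0\<close>: since \<open>\<bar>x\<bar> - inf \<bar>x\<bar> (n v) = (\<bar>x\<bar> - n v)\<^sup>+\<close>, its
  elements are those whose modulus is approximated by its truncations at multiples of \<open>v\<close>. This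
  description makes closedness and the ideal property elementary.\<close>

definition closed_principal_ideal :: "'a::banach_lattice \<Rightarrow> 'a set" where
  "closed_principal_ideal v = {x. \<forall>e>0. \<exists>n::nat. norm (pprt (\<bar>x\<bar> - real n *\<^sub>R v)) < e}"

lemma closed_principal_idealD:
  assumes "x \<in> closed_principal_ideal v" "e > 0"
  obtains n :: nat where "norm (pprt (\<bar>x\<bar> - real n *\<^sub>R v)) < e"
  using assms by (auto simp: closed_principal_ideal_def)

definition quasi_interior :: "'a::banach_lattice \<Rightarrow> bool" where
  "quasi_interior v \<longleftrightarrow> closed_principal_ideal v = UNIV"

lemma pprt_diff_antimono:
  fixes x y v w :: "'a::banach_lattice"
  assumes "x \<le> y" "w \<le> v"
  shows "norm (pprt (x - v)) \<le> norm (pprt (y - w))"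
  using assms by (intro norm_mono_nonneg pprt_mono diff_mono) auto

lemma closed_principal_ideal_add:
  assumes "x \<in> closed_principal_ideal v" "y \<in> closed_principal_ideal v"
  shows "x + y \<in> closed_principal_ideal v"
  unfolding closed_principal_ideal_def
proof (intro CollectI allI impI)
  fix e :: real assume "e > 0"
  then have e: "e / 2 > 0"
    by simp
  obtain n m :: nat where nm: "norm (pprt (\<bar>x\<bar> - real n *\<^sub>R v)) < e / 2"
      "norm (pprt (\<bar>y\<bar> - real m *\<^sub>R v)) < e / 2"
    using closed_principal_idealD[OF assms(1) e] closed_principal_idealD[OF assms(2) e] by metis
  have "norm (pprt (\<bar>x + y\<bar> - real (n + m) *\<^sub>R v))
      \<le> norm (pprt (\<bar>x\<bar> + \<bar>y\<bar> - real (n + m) *\<^sub>R v))"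
    by (intro pprt_diff_antimono) (auto intro: abs_triangle_ineq)
  also have "\<bar>x\<bar> + \<bar>y\<bar> - real (n + m) *\<^sub>R v = (\<bar>x\<bar> - real n *\<^sub>R v) + (\<bar>y\<bar> - real m *\<^sub>R v)"
    by (simp add: scaleR_add_left)
  also have "norm (pprt \<dots>) \<le> norm (pprt (\<bar>x\<bar> - real n *\<^sub>R v) + pprt (\<bar>y\<bar> - real m *\<^sub>R v))"
    by (intro norm_mono_nonneg pprt_add_le) simp
  also have "\<dots> < e"
    using nm norm_triangle_ineq[of "pprt (\<bar>x\<bar> - real n *\<^sub>R v)" "pprt (\<bar>y\<bar> - real m *\<^sub>R v)"]
    by linarith
  finally show "\<exists>n::nat. norm (pprt (\<bar>x + y\<bar> - real n *\<^sub>R v)) < e"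
    by blast
qed

text \<open>Scalar multiples, solidity and invariance under operators with \<open>A v \<le> c v\<close> are all instances: take
  a multiple of the identity, the identity, and \<open>A\<close> itself.\<close>

lemma closed_principal_ideal_dominated:
  fixes A :: "'a::banach_lattice \<Rightarrow>\<^sub>L 'a"
  assumes "v \<ge> 0" "positive_op A" "A v \<le> c *\<^sub>R v" "x \<in> closed_principal_ideal v" "\<bar>y\<bar> \<le> A \<bar>x\<bar>"
  shows "y \<in> closed_principal_ideal v"
  unfolding closed_principal_ideal_def
proof (intro CollectI allI impI)
  fix e :: real assume "e > 0"
  then have "e / (norm A + 1) > 0"
    by (simp add: add_nonneg_pos)
  then obtain n :: nat where n: "norm (pprt (\<bar>x\<bar> - real n *\<^sub>R v)) < e / (norm A + 1)"
    using assms(4) unfolding closed_principal_ideal_def by blast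
  obtain m :: nat where m: "real n * c \<le> real m"
    using real_arch_simple by blast
  let ?p = "pprt (\<bar>x\<bar> - real n *\<^sub>R v)"
  have "\<bar>x\<bar> \<le> ?p + real n *\<^sub>R v"
    using le_pprt[of "\<bar>x\<bar> - real n *\<^sub>R v"] by (simp add: diff_le_eq)
  then have "\<bar>y\<bar> \<le> A ?p + real n *\<^sub>R A v"
    using order_trans[OF assms(5) positive_op_mono[OF assms(2)]]
    by (metis blinfun.add_right blinfun.scaleR_right)
  also have "\<dots> \<le> A ?p + real n *\<^sub>R (c *\<^sub>R v)"
    using assms(3) by (intro add_left_mono scaleR_left_mono) auto
  also have "\<dots> \<le> A ?p + real m *\<^sub>R v"
    using m assms(1) by (auto intro: scaleR_right_mono)
  finally have "pprt (\<bar>y\<bar> - real m *\<^sub>R v) \<le> A ?p"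
    using assms(2) by (intro pprt_least) (auto simp: diff_le_eq positive_op_def)
  then have "norm (pprt (\<bar>y\<bar> - real m *\<^sub>R v)) \<le> norm (A ?p)"
    by (intro norm_mono_nonneg) auto
  also have "\<dots> \<le> norm A * norm ?p"
    by (rule norm_blinfun)
  also have "\<dots> \<le> (norm A + 1) * norm ?p"
    by (intro mult_right_mono) auto
  also have "\<dots> < e"
    using n by (simp add: pos_less_divide_eq add_nonneg_pos mult.commute)
  finally show "\<exists>n::nat. norm (pprt (\<bar>y\<bar> - real n *\<^sub>R v)) < e"
    by blast
qed

lemma closed_principal_ideal:
  fixes v :: "'a::banach_lattice"
  assumes v: "v \<ge> 0"
  shows "lattice_ideal (closed_principal_ideal v)" "closed (closed_principal_ideal v)"
    "v \<in> closed_principal_ideal v"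
proof -
  show "v \<in> closed_principal_ideal v"
    unfolding closed_principal_ideal_def
  proof (intro CollectI allI impI)
    show "\<exists>n::nat. norm (pprt (\<bar>v\<bar> - real n *\<^sub>R v)) < e" if "e > 0" for e :: real
      using that v by (intro exI[of _ 1]) simp
  qed
  have 0: "0 \<in> closed_principal_ideal v"
    unfolding closed_principal_ideal_def by (auto intro: exI[of _ 0])
  have scale: "c *\<^sub>R x \<in> closed_principal_ideal v" if "x \<in> closed_principal_ideal v" for c x
    by (rule closed_principal_ideal_dominated[of v "\<bar>c\<bar> *\<^sub>R id_blinfun" "\<bar>c\<bar>" x])
      (use v that in \<open>auto simp: positive_op_def blinfun.scaleR_left abs_scaleR_le
         intro: scaleR_nonneg_nonneg\<close>)
  have "subspace (closed_principal_ideal v)"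
    unfolding subspace_def using 0 closed_principal_ideal_add scale by blast
  moreover have "x \<in> closed_principal_ideal v"
    if "y \<in> closed_principal_ideal v" "\<bar>x\<bar> \<le> \<bar>y\<bar>" for x y
    by (rule closed_principal_ideal_dominated[of v id_blinfun 1 y])
      (use v that in \<open>auto simp: positive_op_def\<close>)
  ultimately show "lattice_ideal (closed_principal_ideal v)"
    by (auto simp: lattice_ideal_def)
  have "x \<in> closed_principal_ideal v" if x: "x \<in> closure (closed_principal_ideal v)" for x
    unfolding closed_principal_ideal_def
  proof (intro CollectI allI impI)
    fix e :: real assume "e > 0"
    then have e: "e / 2 > 0"
      by simp
    then obtain y where y: "y \<in> closed_principal_ideal v" "dist y x < e / 2"
      using x by (meson closure_approachable)
    obtain n :: nat where n: "norm (pprt (\<bar>y\<bar> - real n *\<^sub>R v)) < e / 2"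
      using closed_principal_idealD[OF y(1) e] .
    let ?p = "pprt (\<bar>y\<bar> - real n *\<^sub>R v)"
    have "\<bar>x\<bar> \<le> \<bar>x - y\<bar> + \<bar>y\<bar>"
      using abs_triangle_ineq[of "x - y" y] by simp
    moreover have "\<bar>y\<bar> - real n *\<^sub>R v \<le> ?p"
      by (rule le_pprt)
    ultimately have "\<bar>x\<bar> + (\<bar>y\<bar> - real n *\<^sub>R v) \<le> (\<bar>x - y\<bar> + \<bar>y\<bar>) + ?p"
      by (rule add_mono)
    then have "\<bar>x\<bar> - real n *\<^sub>R v \<le> \<bar>x - y\<bar> + ?p"
      by (simp add: algebra_simps)
    then have "norm (pprt (\<bar>x\<bar> - real n *\<^sub>R v)) \<le> norm (\<bar>x - y\<bar> + ?p)"
      by (intro norm_mono_nonneg pprt_least) auto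
    also have "\<dots> \<le> norm (x - y) + norm ?p"
      using norm_triangle_ineq[of "\<bar>x - y\<bar>" ?p] by simp
    also have "\<dots> < e"
      using y(2) n by (simp add: dist_norm norm_minus_commute)
    finally show "\<exists>n::nat. norm (pprt (\<bar>x\<bar> - real n *\<^sub>R v)) < e"
      by blast
  qed
  then show "closed (closed_principal_ideal v)"
    by (meson closure_subset_eq subsetI)
qed

text \<open>A vector with \<open>T v \<le> c v\<close> generates an invariant ideal, so density comes for free.\<close>

lemma ideal_irreducible_quasi_interior:
  fixes T :: "'a::banach_lattice \<Rightarrow>\<^sub>L 'a"
  assumes "ideal_irreducible T" "positive_op T" "v > 0" "T v \<le> c *\<^sub>R v"
  shows "quasi_interior v"
proof (rule ccontr)
  assume "\<not> quasi_interior v"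
  moreover have v: "v \<ge> 0" "v \<noteq> 0"
    using assms(3) by auto
  then have "closed_principal_ideal v \<noteq> {0}"
    using closed_principal_ideal(3)[OF v(1)] by blast
  ultimately have "nontrivial_closed_ideal (closed_principal_ideal v)"
    using closed_principal_ideal(1,2)[OF v(1)]
    by (simp add: nontrivial_closed_ideal_def quasi_interior_def)
  moreover have "invariant_under T (closed_principal_ideal v)"
    unfolding invariant_under_def
  proof
    show "T x \<in> closed_principal_ideal v" if "x \<in> closed_principal_ideal v" for x
      by (rule closed_principal_ideal_dominated[OF v(1) assms(2,4) that positive_op_abs[OF assms(2)]])
  qed
  ultimately show False
    using assms(1) by (auto simp: ideal_irreducible_def)
qed

lemma positive_op_eq_0_if_quasi_interior:
  fixes A :: "'a::banach_lattice \<Rightarrow>\<^sub>L 'b::banach_lattice"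
  assumes "positive_op A" "quasi_interior v" "A v = 0"
  shows "A = 0"
proof -
  have bound: "norm (A x) \<le> norm A * e" if e: "e > 0" for x e
  proof -
    have "x \<in> closed_principal_ideal v"
      using assms(2) by (simp add: quasi_interior_def)
    then obtain n :: nat where n: "norm (pprt (\<bar>x\<bar> - real n *\<^sub>R v)) < e"
      using closed_principal_idealD e by blast
    let ?p = "pprt (\<bar>x\<bar> - real n *\<^sub>R v)"
    have "A \<bar>x\<bar> \<le> A (?p + real n *\<^sub>R v)"
      using le_pprt[of "\<bar>x\<bar> - real n *\<^sub>R v"]
      by (intro positive_op_mono[OF assms(1)]) (simp add: diff_le_eq)
    also have "\<dots> = A ?p"
      by (simp add: blinfun.add_right blinfun.scaleR_right assms(3))
    finally have "norm (A \<bar>x\<bar>) \<le> norm (A ?p)"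
      using assms(1) by (intro norm_mono_nonneg) (auto simp: positive_op_def)
    also have "\<dots> \<le> norm A * norm ?p"
      by (rule norm_blinfun)
    also have "\<dots> \<le> norm A * e"
      using n by (intro mult_left_mono) auto
    finally show ?thesis
      using norm_positive_op_abs[OF assms(1), of x] by simp
  qed
  have "norm (A x) \<le> 0" for x
  proof (rule field_le_epsilon)
    fix e :: real assume "e > 0"
    then have e: "e / (norm A + 1) > 0"
      by (simp add: add_nonneg_pos)
    have "norm (A x) \<le> norm A * (e / (norm A + 1))"
      by (rule bound[OF e])
    also have "\<dots> \<le> (norm A + 1) * (e / (norm A + 1))"
      using e by (intro mult_right_mono) auto
    also have "\<dots> = e"
      using norm_ge_zero[of A] by (simp add: add_nonneg_eq_0_iff)
    finally show "norm (A x) \<le> 0 + e"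
      by simp
  qed
  then show ?thesis
    by (intro blinfun_eqI) simp
qed

text \<open>Because \<open>f \<circ> T \<le> c f\<close>, the null ideal \<open>{y. f \<bar>y\<bar> = 0}\<close> is invariant under \<open>T\<close>, so it is trivial.\<close>

lemma ideal_irreducible_strictly_positive:
  fixes T :: "'a::banach_lattice \<Rightarrow>\<^sub>L 'a" and f :: "'a \<Rightarrow>\<^sub>L real"
  assumes T: "ideal_irreducible T" "positive_op T" and f: "positive_op f" "f \<noteq> 0"
    and sub: "\<And>x. x \<ge> 0 \<Longrightarrow> f (T x) \<le> c * f x" and x: "x > 0"
  shows "f x > 0"
proof (rule ccontr)
  assume "\<not> f x > 0"
  then have fx: "f x = 0"
    using f(1) x by (simp add: positive_op_def order_less_le)
  define J where "J = {y. f \<bar>y\<bar> = 0}"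
  have nonneg: "f y \<ge> 0" if "y \<ge> 0" for y
    using f(1) that by (simp add: positive_op_def)
  have J: "y \<in> J" if "\<bar>y\<bar> \<le> z" "f z \<le> 0" for y z
    using positive_op_mono[OF f(1) that(1)] nonneg[of "\<bar>y\<bar>"] that(2) by (simp add: J_def)
  have "J = {y. f (pprt y + pprt (- y)) = 0}"
    by (simp add: J_def abs_prts pprt_neg)
  moreover have "closed {y. f (pprt y + pprt (- y)) = 0}"
    by (intro closed_Collect_eq continuous_intros)
  ultimately have "closed J"
    by simp
  moreover have "lattice_ideal J"
    unfolding lattice_ideal_def subspace_def
  proof (intro conjI ballI allI impI)
    show "0 \<in> J"
      by (simp add: J_def)
    show "y + z \<in> J" if "y \<in> J" "z \<in> J" for y z
      by (rule J[OF abs_triangle_ineq]) (use that in \<open>simp add: J_def blinfun.add_right\<close>)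
    show "c *\<^sub>R y \<in> J" if "y \<in> J" for y c
      by (rule J[OF abs_scaleR_le]) (use that in \<open>simp add: J_def blinfun.scaleR_right\<close>)
    show "y \<in> J" if "z \<in> J \<and> \<bar>y\<bar> \<le> \<bar>z\<bar>" for y z
      using J that by (auto simp: J_def)
  qed
  moreover have "invariant_under T J"
    unfolding invariant_under_def
  proof
    show "T y \<in> J" if "y \<in> J" for y
      by (rule J[OF positive_op_abs[OF T(2)]]) (use sub[of "\<bar>y\<bar>"] that in \<open>simp add: J_def\<close>)
  qed
  moreover have "x \<in> J" "x \<noteq> 0"
    using x fx by (auto simp: J_def)
  moreover have "J \<noteq> UNIV"
  proof
    assume "J = UNIV"
    then have "f \<bar>y\<bar> = 0" for y
      by (auto simp: J_def)
    then have "f y = 0" for y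
      using norm_positive_op_abs[OF f(1), of y] by simp
    then show False
      using f(2) by (metis blinfun_eqI zero_blinfun.rep_eq)
  qed
  ultimately show False
    using T(1) by (auto simp: ideal_irreducible_def nontrivial_closed_ideal_def)
qed

section \<open>Growth of powers\<close>

text \<open>A positive version of the argument of Lomonosov and Hilden. For some \<open>x\<close>, truncating a multiple of
  \<open>R (K u)\<close> at \<open>x\<close> returns every \<open>u\<close> of a ball around \<open>x\<close> to this ball, and compactness makes one
  multiple \<open>N\<close> suffice for all \<open>u\<close>. Iterating, the ball contains for every \<open>k\<close> a vector below
  \<open>N\<^sup>k (R K)\<^sup>k x\<close>, so that the norms of these vectors stay away from zero.\<close>

lemma growth_of_powers:
  fixes R K :: "'a::banach_lattice \<Rightarrow>\<^sub>L 'a"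
  assumes K: "compact_op K" "positive_op K" "K \<noteq> 0"
    and R: "positive_op R" "\<And>y. y > 0 \<Longrightarrow> quasi_interior (R y)"
  obtains x a e where "x \<ge> 0" "a > 0" "e > 0" "\<And>n. e * a ^ n \<le> norm (blinfun_pow (R o\<^sub>L K) n x)"
proof -
  have "\<exists>x\<ge>0. K x \<noteq> 0"
  proof (rule ccontr)
    assume "\<not> ?thesis"
    then have "norm K \<le> 0"
      by (intro norm_positive_op_bound K) auto
    then show False
      using K(3) by simp
  qed
  then obtain x where x: "x \<ge> 0" "K x \<noteq> 0"
    by blast
  have nx: "norm x > 0"
    using x by auto
  \<comment> \<open>The ball of radius \<open>d\<close> around \<open>x\<close> avoids \<open>0\<close>, and so does the closure of its image under \<open>K\<close>.\<close>
  define d where "d = min (norm x / 2) (norm (K x) / (2 * norm K))"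
  have d: "d > 0" "d < norm x" "norm K * d \<le> norm (K x) / 2"
  proof -
    have "norm K * d \<le> norm K * (norm (K x) / (2 * norm K))"
      by (intro mult_left_mono) (auto simp: d_def)
    then show "norm K * d \<le> norm (K x) / 2"
      using K(3) by simp
    show "d > 0"
      using nx x K(3) by (simp add: d_def)
    have "d \<le> norm x / 2"
      by (simp add: d_def)
    then show "d < norm x"
      using nx by linarith
  qed
  define U where "U = {u. 0 \<le> u \<and> norm (u - x) \<le> d}"
  define C where "C = closure (K ` U)"
  have "bounded U"
    by (rule bounded_subset[of "cball x d"]) (auto simp: U_def dist_norm norm_minus_commute)
  then have "compact C"
    unfolding C_def by (intro compact_op_closure_image K)
  have "C \<subseteq> {y. 0 \<le> y} \<inter> {y. norm (K x) / 2 \<le> norm y}"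
    unfolding C_def
  proof (rule closure_minimal)
    show "closed ({y :: 'a. 0 \<le> y} \<inter> {y. norm (K x) / 2 \<le> norm y})"
      by (rule closed_Int[OF closed_nonneg_cone]) (intro closed_Collect_le continuous_intros)
    have "norm (K x) / 2 \<le> norm (K u)" if "u \<in> U" for u
    proof -
      have "norm (K (u - x)) \<le> norm K * norm (u - x)"
        by (rule norm_blinfun)
      also have "\<dots> \<le> norm K * d"
        using that by (intro mult_left_mono) (auto simp: U_def)
      finally have "norm (K x - K u) \<le> norm (K x) / 2"
        using d(3) by (simp add: blinfun.diff_right norm_minus_commute)
      then show ?thesis
        using norm_triangle_ineq2[of "K x" "K u"] by linarith
    qed
    then show "K ` U \<subseteq> {y. 0 \<le> y} \<inter> {y. norm (K x) / 2 \<le> norm y}"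
      using K(2) by (auto simp: U_def positive_op_def)
  qed
  then have C: "y > 0" if "y \<in> C" for y
    using that x(2) by (auto simp: order_less_le)
  define W where "W n = {y. norm (pprt (x - real n *\<^sub>R R y)) < d}" for n
  have "open (W n)" if "n \<in> UNIV" for n
    unfolding W_def by (intro open_Collect_less continuous_intros)
  moreover have "C \<subseteq> (\<Union>n. W n)"
  proof
    fix y assume "y \<in> C"
    then have "x \<in> closed_principal_ideal (R y)"
      using R(2)[OF C] by (simp add: quasi_interior_def)
    then obtain n :: nat where "norm (pprt (\<bar>x\<bar> - real n *\<^sub>R R y)) < d"
      using closed_principal_idealD d(1) by blast
    then show "y \<in> (\<Union>n. W n)"
      using x(1) by (auto simp: W_def)
  qed
  ultimately obtain D where D: "finite D" "C \<subseteq> (\<Union>n\<in>D. W n)"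
    by (rule compactE_image[OF \<open>compact C\<close>])
  obtain N where N: "N > 0" "\<And>n. n \<in> D \<Longrightarrow> n \<le> N"
  proof -
    obtain m where "\<forall>n\<in>D. n \<le> m"
      using D(1) finite_nat_set_iff_bounded_le by blast
    then show thesis
      using that[of "Suc m"] by fastforce
  qed
  have trunc: "norm (pprt (x - real N *\<^sub>R R y)) < d" if yC: "y \<in> C" for y
  proof -
    obtain n where n: "n \<in> D" "norm (pprt (x - real n *\<^sub>R R y)) < d"
      using yC D(2) by (auto simp: W_def)
    have "R y \<ge> 0"
      using R(1) C[OF yC] by (auto simp: positive_op_def)
    then have "norm (pprt (x - real N *\<^sub>R R y)) \<le> norm (pprt (x - real n *\<^sub>R R y))"
      using N(2)[OF n(1)] by (intro pprt_diff_antimono scaleR_right_mono) auto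
    then show ?thesis
      using n(2) by simp
  qed
  have iter: "\<exists>u\<in>U. u \<le> real N ^ k *\<^sub>R blinfun_pow (R o\<^sub>L K) k x" for k
  proof (induction k)
    case 0
    show ?case
      using x d by (intro bexI[of _ x]) (auto simp: U_def)
  next
    case (Suc k)
    then obtain u where u: "u \<in> U" "u \<le> real N ^ k *\<^sub>R blinfun_pow (R o\<^sub>L K) k x"
      by blast
    have Q: "positive_op (R o\<^sub>L K)"
      using R(1) K(2) by (rule positive_op_compose)
    define w where "w = real N *\<^sub>R (R o\<^sub>L K) u"
    have "0 \<le> (R o\<^sub>L K) u"
      using Q u(1) unfolding positive_op_def U_def by blast
    then have w: "0 \<le> w"
      unfolding w_def by (intro scaleR_nonneg_nonneg) auto
    have "x - pprt (x - w) \<in> U"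
    proof -
      have "K u \<in> C"
        using u(1) closure_subset[of "K ` U"] by (auto simp: C_def)
      then have "norm (pprt (x - w)) \<le> d"
        using trunc[of "K u"] by (simp add: w_def)
      moreover have "pprt (x - w) \<le> x"
        using w x(1) by (intro pprt_least) auto
      ultimately show ?thesis
        by (simp add: U_def)
    qed
    moreover have "x - pprt (x - w) \<le> w"
      using le_pprt[of "x - w"] by (simp add: algebra_simps)
    moreover have "w \<le> real N *\<^sub>R (R o\<^sub>L K) (real N ^ k *\<^sub>R blinfun_pow (R o\<^sub>L K) k x)"
      unfolding w_def using positive_op_mono[OF Q u(2)] by (intro scaleR_left_mono) auto
    ultimately show ?case
      by (intro bexI[of _ "x - pprt (x - w)"]) (auto simp: blinfun.scaleR_right)
  qed
  show thesis
  proof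
    show "x \<ge> 0" "1 / real N > 0" "norm x - d > 0"
      using x N d by auto
    fix n
    obtain u where u: "u \<in> U" "u \<le> real N ^ n *\<^sub>R blinfun_pow (R o\<^sub>L K) n x"
      using iter by blast
    have "norm x - d \<le> norm u"
      using u(1) norm_triangle_ineq2[of x u] by (simp add: U_def norm_minus_commute)
    also have "\<dots> \<le> norm (real N ^ n *\<^sub>R blinfun_pow (R o\<^sub>L K) n x)"
      using u by (intro norm_mono_nonneg) (auto simp: U_def)
    finally show "(norm x - d) * (1 / real N) ^ n \<le> norm (blinfun_pow (R o\<^sub>L K) n x)"
      using N(1) by (simp add: field_simps)
  qed
qed

lemma le_liminf_root:
  fixes X :: "nat \<Rightarrow> real"
  assumes "e > 0" "t > 0" "\<And>n. e * t ^ n \<le> X n"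
  shows "ereal t \<le> liminf (\<lambda>n. ereal (root n (X n)))"
proof -
  have "(\<lambda>n. root n e * t) \<longlonglongrightarrow> 1 * t"
    by (intro tendsto_intros LIMSEQ_root_const assms)
  then have "(\<lambda>n. ereal (root n e * t)) \<longlonglongrightarrow> ereal t"
    by simp
  then have "liminf (\<lambda>n. ereal (root n e * t)) = ereal t"
    by (rule lim_imp_Liminf[OF sequentially_bot])
  moreover have "\<forall>\<^sub>F n in sequentially. ereal (root n e * t) \<le> ereal (root n (X n))"
  proof (rule eventually_mono[OF eventually_gt_at_top[of 0]])
    fix n :: nat assume "0 < n"
    then have "root n (e * t ^ n) = root n e * t"
      using assms(2) by (simp add: real_root_mult real_root_power_cancel)
    then show "ereal (root n e * t) \<le> ereal (root n (X n))"
      using assms(3)[of n] \<open>0 < n\<close> by (metis ereal_less_eq(3) real_root_le_mono)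
  qed
  then have "liminf (\<lambda>n. ereal (root n e * t)) \<le> liminf (\<lambda>n. ereal (root n (X n)))"
    by (rule Liminf_mono)
  ultimately show ?thesis
    by simp
qed

section \<open>Common eigenvectors\<close>

text \<open>Applying \<open>g\<close> to the value of the commutator at \<open>y\<close> gives zero. Strict positivity of \<open>g\<close> removes
  \<open>g\<close>, and density of the ideal of \<open>y\<close> then removes \<open>y\<close>.\<close>

lemma positive_commutator_eq_0:
  fixes A S D :: "'a::banach_lattice \<Rightarrow>\<^sub>L 'a" and g :: "'a \<Rightarrow>\<^sub>L real"
  assumes y: "quasi_interior y" "y \<ge> 0" "A y = a *\<^sub>R y"
    and g: "\<And>x. x > 0 \<Longrightarrow> g x > 0" "\<And>x. g (A x) = a * g x"
    and D: "positive_op D" "D = (A o\<^sub>L S) - (S o\<^sub>L A) \<or> D = (S o\<^sub>L A) - (A o\<^sub>L S)"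
  shows "D = 0"
proof (rule positive_op_eq_0_if_quasi_interior[OF D(1) y(1)])
  have "D y \<ge> 0"
    using D(1) y(2) by (simp add: positive_op_def)
  moreover have "g (D y) = 0"
    using D(2) by (auto simp: blinfun.diff_left blinfun.diff_right blinfun.scaleR_right y(3) g(2))
  ultimately show "D y = 0"
    using g(1)[of "D y"] by (auto simp: order_less_le)
qed

text \<open>Put \<open>y = R x\<close> and \<open>g = f \<circ> R\<close>. With the same sign throughout, \<open>E x = \<plusminus> (q y - Q y)\<close> and
  \<open>f \<circ> E = \<plusminus> (g \<circ> Q - q g)\<close>. Both are positive, but the value of \<open>g\<close> at the former is the negative
  of the value of the latter at \<open>y\<close>. So both values vanish, and with them \<open>E x\<close> and \<open>f \<circ> E\<close>.\<close>

lemma eigenpair_transfer: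
  fixes Q R E :: "'a::banach_lattice \<Rightarrow>\<^sub>L 'a" and f :: "'a \<Rightarrow>\<^sub>L real"
  assumes x: "x \<ge> 0" "Q x = q *\<^sub>R x" and f: "positive_op f" "\<And>z. f (Q z) = q * f z"
    and E: "positive_op E" "E = (R o\<^sub>L Q) - (Q o\<^sub>L R) \<or> E = (Q o\<^sub>L R) - (R o\<^sub>L Q)"
    and R: "positive_op R" "quasi_interior (R x)" and strict: "\<And>z. z > 0 \<Longrightarrow> f (R z) > 0"
  shows "Q (R x) = q *\<^sub>R R x" "f (R (Q z)) = q * f (R z)"
proof -
  have Ex: "E x = q *\<^sub>R R x - Q (R x) \<or> E x = Q (R x) - q *\<^sub>R R x"
    using E(2) by (auto simp: blinfun.diff_left blinfun.scaleR_right x(2))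
  have fE: "f (E z) = f (R (Q z)) - q * f (R z)" if "E = (R o\<^sub>L Q) - (Q o\<^sub>L R)" for z
    by (simp add: that blinfun.diff_left blinfun.diff_right f(2))
  have fE': "f (E z) = q * f (R z) - f (R (Q z))" if "E = (Q o\<^sub>L R) - (R o\<^sub>L Q)" for z
    by (simp add: that blinfun.diff_left blinfun.diff_right f(2))
  have Ex0: "E x \<ge> 0" and ERx: "f (E (R x)) \<ge> 0"
  proof -
    show "E x \<ge> 0"
      using E(1) x(1) by (simp add: positive_op_def)
    show "f (E (R x)) \<ge> 0"
      using E(1) f(1) R x(1) by (simp add: positive_op_def)
  qed
  have fREx: "f (R (E x)) = - f (E (R x))"
    using E(2)
  proof
    assume E: "E = (R o\<^sub>L Q) - (Q o\<^sub>L R)"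
    then have "E x = q *\<^sub>R R x - Q (R x)"
      by (simp add: blinfun.diff_left blinfun.scaleR_right x(2))
    then show ?thesis
      by (simp add: fE[OF E] blinfun.diff_right blinfun.scaleR_right)
  next
    assume E: "E = (Q o\<^sub>L R) - (R o\<^sub>L Q)"
    then have "E x = Q (R x) - q *\<^sub>R R x"
      by (simp add: blinfun.diff_left blinfun.scaleR_right x(2))
    then show ?thesis
      by (simp add: fE'[OF E] blinfun.diff_right blinfun.scaleR_right)
  qed
  then have "\<not> f (R (E x)) > 0"
    using ERx by simp
  then have "E x = 0"
    using strict[of "E x"] Ex0 by (auto simp: order_less_le)
  then show "Q (R x) = q *\<^sub>R R x"
    using Ex by auto
  have "f o\<^sub>L E = 0"
  proof (rule positive_op_eq_0_if_quasi_interior[OF _ R(2)])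
    show "positive_op (f o\<^sub>L E)"
      using f(1) E(1) by (rule positive_op_compose)
    show "(f o\<^sub>L E) (R x) = 0"
      using fREx \<open>E x = 0\<close> by simp
  qed
  then have "f (E z) = 0"
    by (metis blinfun_apply_blinfun_compose zero_blinfun.rep_eq)
  then show "f (R (Q z)) = q * f (R z)"
    using E(2) fE[of z] fE'[of z] by auto
qed

lemma quasi_interior_disjoint:
  fixes u w :: "'a::banach_lattice"
  assumes "quasi_interior u" "u \<ge> 0" "w \<ge> 0" "inf w u = 0"
  shows "w = 0"
proof -
  have inf0: "inf w (real n *\<^sub>R u) \<le> 0" for n
  proof (induction n)
    case (Suc n)
    let ?v = "inf w (real (Suc n) *\<^sub>R u)"
    have nu: "real n *\<^sub>R u \<ge> 0"
      using assms(2) by (simp add: scaleR_nonneg_nonneg)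
    have "?v \<le> real (Suc n) *\<^sub>R u"
      by simp
    then have "?v - real n *\<^sub>R u \<le> u"
      by (simp add: scaleR_add_left diff_le_eq add.commute)
    moreover have "?v - real n *\<^sub>R u \<le> w"
      using nu by (meson diff_le_eq inf_le1 le_add_same_cancel1 order_trans)
    ultimately have "?v - real n *\<^sub>R u \<le> 0"
      using assms(4) by (metis le_inf_iff)
    then have "?v \<le> inf w (real n *\<^sub>R u)"
      by simp
    then show ?case
      using Suc.IH by (rule order_trans)
  qed simp
  have "norm w \<le> 0"
  proof (rule field_le_epsilon)
    fix e :: real assume "e > 0"
    moreover have "w \<in> closed_principal_ideal u"
      using assms(1) by (simp add: quasi_interior_def)
    ultimately obtain n :: nat where n: "norm (pprt (\<bar>w\<bar> - real n *\<^sub>R u)) < e"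
      using closed_principal_idealD by blast
    let ?p = "pprt (w - real n *\<^sub>R u)"
    have "w - ?p \<le> real n *\<^sub>R u"
      using le_pprt[of "w - real n *\<^sub>R u"] by (simp add: algebra_simps)
    then have "w - ?p \<le> inf w (real n *\<^sub>R u)"
      by simp
    then have "w - ?p \<le> 0"
      using inf0 by (rule order_trans)
    then have "w \<le> ?p"
      by simp
    then have "norm w \<le> norm ?p"
      using assms(3) by (rule norm_mono_nonneg[rotated])
    then show "norm w \<le> 0 + e"
      using n assms(3) by simp
  qed
  then show ?thesis
    by simp
qed

text \<open>With \<open>z\<close> also \<open>\<bar>z\<bar>\<close>, \<open>z\<^sup>+\<close> and \<open>z\<^sup>-\<close> are eigenvectors. If \<open>z\<^sup>+ \<noteq> 0\<close>, it is quasi-interior, and then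
  the disjoint vector \<open>z\<^sup>-\<close> vanishes. Hence every eigenvector has a sign. As \<open>g\<close> is strictly positive
  and vanishes at \<open>x - (g x / g y) y\<close>, this vector must be zero.\<close>

lemma eigenspace_one_dimensional:
  fixes A :: "'a::banach_lattice \<Rightarrow>\<^sub>L 'a" and g :: "'a \<Rightarrow>\<^sub>L real"
  assumes A: "positive_op A" and a: "a \<ge> 0" and y: "y > 0" "A y = a *\<^sub>R y"
    and g: "\<And>x. x > 0 \<Longrightarrow> g x > 0" "\<And>x. g (A x) = a * g x"
    and qi: "\<And>x. x > 0 \<Longrightarrow> A x = a *\<^sub>R x \<Longrightarrow> quasi_interior x"
    and x: "A x = a *\<^sub>R x"
  shows "x = (g x / g y) *\<^sub>R y"
proof -
  have sign: "z \<ge> 0 \<or> z \<le> 0" if z: "A z = a *\<^sub>R z" for z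
  proof -
    have "a *\<^sub>R z \<le> A \<bar>z\<bar>" "a *\<^sub>R (- z) \<le> A \<bar>z\<bar>"
      using positive_op_mono[OF A, of z "\<bar>z\<bar>"] positive_op_mono[OF A, of "- z" "\<bar>z\<bar>"] z
      by (auto simp: blinfun.minus_right)
    have "a *\<^sub>R \<bar>z\<bar> \<le> A \<bar>z\<bar>"
    proof (cases "a = 0")
      case True
      then show ?thesis
        using A by (simp add: positive_op_def)
    next
      case False
      then have "\<bar>z\<bar> \<le> A \<bar>z\<bar> /\<^sub>R a"
        using a \<open>a *\<^sub>R z \<le> A \<bar>z\<bar>\<close> \<open>a *\<^sub>R (- z) \<le> A \<bar>z\<bar>\<close>
        by (intro abs_leI) (simp_all add: pos_le_divideR_eq)
      then show ?thesis
        using a False by (simp add: pos_le_divideR_eq)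
    qed
    then have "A \<bar>z\<bar> - a *\<^sub>R \<bar>z\<bar> \<ge> 0"
      by simp
    moreover have "g (A \<bar>z\<bar> - a *\<^sub>R \<bar>z\<bar>) = 0"
      by (simp add: blinfun.diff_right blinfun.scaleR_right g(2))
    ultimately have abs_z: "A \<bar>z\<bar> = a *\<^sub>R \<bar>z\<bar>"
      using g(1)[of "A \<bar>z\<bar> - a *\<^sub>R \<bar>z\<bar>"] by (auto simp: order_less_le)
    have prt: "z - nprt z = pprt z"
      by (metis prts add_diff_cancel_right')
    have p: "pprt z = (\<bar>z\<bar> + z) /\<^sub>R 2"
    proof -
      have "\<bar>z\<bar> + z = pprt z + (z - nprt z)"
        by (simp add: abs_prts)
      then have "\<bar>z\<bar> + z = pprt z + pprt z"
        by (simp only: prt)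
      then show ?thesis
        by (simp flip: scaleR_2)
    qed
    have "A (pprt z) = a *\<^sub>R pprt z"
      by (simp add: p blinfun.scaleR_right blinfun.add_right abs_z z scaleR_add_right)
    moreover have "inf (pprt (- z)) (pprt z) = 0"
    proof -
      have "inf (pprt (- z)) (pprt z) = inf (0 + pprt (- z)) (z + pprt (- z))"
        by (simp add: pprt_neg prt)
      also have "\<dots> = inf 0 z + pprt (- z)"
        by (simp only: add_inf_distrib_right)
      also have "\<dots> = 0"
        by (simp add: inf.commute[of 0 z] pprt_neg flip: nprt_def)
      finally show ?thesis .
    qed
    ultimately have "pprt z = 0 \<or> pprt (- z) = 0"
      using qi[of "pprt z"] quasi_interior_disjoint[of "pprt z" "pprt (- z)"]
      by (auto simp: order_less_le)
    then show ?thesis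
      by (auto simp flip: le_zero_iff_zero_pprt)
  qed
  define z where "z = x - (g x / g y) *\<^sub>R y"
  have "A z = a *\<^sub>R z"
    using x y(2) by (simp add: z_def blinfun.diff_right blinfun.scaleR_right algebra_simps)
  moreover have "g z = 0"
    using g(1)[OF y(1)] by (simp add: z_def blinfun.diff_right blinfun.scaleR_right)
  ultimately have "z = 0"
    using sign[of z] g(1)[of z] g(1)[of "- z"] by (auto simp: order_less_le blinfun.minus_right)
  then show ?thesis
    by (simp add: z_def)
qed

text \<open>A rank one perturbation makes \<open>q - Q\<close> injective. By the Fredholm alternative, every vector is
  then the sum of a vector in the range of \<open>q - Q\<close>, on which \<open>h\<close> vanishes, and a multiple of \<open>y\<close>.\<close>

lemma eigenfunctional_unique:
  fixes Q :: "'a::banach_lattice \<Rightarrow>\<^sub>L 'a" and g h :: "'a \<Rightarrow>\<^sub>L real"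
  assumes Q: "compact_op Q" and q: "q > 0" and gy: "g y \<noteq> 0"
    and g: "\<And>x. g (Q x) = q * g x" and h: "\<And>x. h (Q x) = q * h x"
    and ker: "\<And>x. Q x = q *\<^sub>R x \<Longrightarrow> x = (g x / g y) *\<^sub>R y"
  shows "h x = (h y / g y) * g x"
proof -
  define C where "C = (inverse q *\<^sub>R id_blinfun o\<^sub>L Q) - (blinfun_scaleR_left (y /\<^sub>R g y) o\<^sub>L g)"
  have C: "C x = Q x /\<^sub>R q - (g x / g y) *\<^sub>R y" for x
    by (simp add: C_def blinfun.diff_left blinfun.scaleR_left divide_inverse)
  have "compact_op C"
    unfolding C_def by (intro compact_op_diff compact_op_compose_left compact_op_rank_one Q)
  moreover have "x = 0" if x: "C x = x" for x
  proof -
    \<comment> \<open>\<open>g\<close> is preserved by \<open>Q / q\<close>, so it sees only the rank one part.\<close>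
    have "g (Q x /\<^sub>R q - (g x / g y) *\<^sub>R y) = g x"
      using x by (simp add: C)
    then have "g x = 0"
      using q gy by (simp add: blinfun.diff_right blinfun.scaleR_right g)
    then have "Q x /\<^sub>R q = x"
      using x by (simp add: C)
    then have "Q x = q *\<^sub>R x"
      using q by (metis less_irrefl scaleR_scaleR right_inverse scaleR_one)
    then show ?thesis
      using ker[of x] \<open>g x = 0\<close> by simp
  qed
  ultimately obtain S where S: "\<And>x. S x - C (S x) = x"
    using Fredholm_alternative[of C] by blast
  define k where "k x = h x - (h y / g y) * g x" for x
  have "k (S x - C (S x)) = 0"
  proof -
    define v where "v = S x"
    have "h (Q v /\<^sub>R q) = h v" "g (Q v /\<^sub>R q) = g v"
      using q by (simp_all add: blinfun.scaleR_right g h)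
    then show ?thesis
      unfolding v_def[symmetric] k_def C
      using gy by (simp add: blinfun.diff_right blinfun.add_right blinfun.scaleR_right)
  qed
  then show ?thesis
    by (simp add: S k_def)
qed

text \<open>The operator \<open>K\<close> itself may have a large eigenspace, on which \<open>T\<close> need not act as a scalar: take for
  \<open>K\<close> the identity in finite dimension. The remedy is to work with \<open>Q = R K\<close>, where \<open>R\<close> is a
  resolvent of \<open>T\<close>. It is compact and semi-commutes with \<open>T\<close> and with \<open>R\<close>; and since \<open>R\<close> maps all
  nonzero positive vectors to quasi-interior ones, all positive eigenvectors of \<open>Q\<close> for nonzero
  eigenvalues are quasi-interior. This makes the eigenspaces of \<open>Q\<close> and of its adjoint for the
  eigenvalue \<open>q\<close> one-dimensional, and operators that commute with \<open>Q\<close> act on them as scalars.\<close>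

theorem common_eigenvectors:
  fixes T K :: "'a::banach_lattice \<Rightarrow>\<^sub>L 'a"
  assumes T: "ideal_irreducible T" "positive_op T" "T \<noteq> 0"
    and K: "compact_op K" "positive_op K" "K \<noteq> 0" and semi: "semi_commute T K"
  obtains y t r and g :: "'a \<Rightarrow>\<^sub>L real"
  where "y > 0" "quasi_interior y" "positive_op g" "\<And>x. x > 0 \<Longrightarrow> g x > 0" "t > 0" "r > 0"
    "T y = t *\<^sub>R y" "K y = r *\<^sub>R y" "\<And>x. g (T x) = t * g x" "\<And>x. g (K x) = r * g x"
    "\<And>x. T x = t *\<^sub>R x \<Longrightarrow> x = (g x / g y) *\<^sub>R y"
proof -
  define c where "c = norm T + 1"
  obtain R where R: "positive_resolvent T c R"
    using positive_resolvent_exists[OF T(2), of c] by (auto simp: c_def)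
  note Rpos = positive_resolventD(1)[OF R] and TR = positive_resolventD(2)[OF R]
    and RT = positive_resolventD(3)[OF R]
  have R_inj: "x = 0" if "R x = 0" for x
    using TR[of x] that by simp
  have R_gt: "R x > 0" if "x > 0" for x
    using Rpos R_inj[of x] that by (auto simp: positive_op_def order_less_le)
  have R_qi: "quasi_interior (R x)" if "x > 0" for x
    by (rule ideal_irreducible_quasi_interior[OF T(1,2) R_gt[OF that], of c])
      (use that in \<open>simp add: TR\<close>)
  define Q where "Q = R o\<^sub>L K"
  have Qpos: "positive_op Q" and Qcomp: "compact_op Q"
    using Rpos K by (simp_all add: Q_def positive_op_compose compact_op_compose_left)
  obtain x a e where growth: "x \<ge> 0" "a > 0" "e > 0" "\<And>n. e * a ^ n \<le> norm (blinfun_pow Q n x)"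
    unfolding Q_def using growth_of_powers[OF K Rpos R_qi] by blast
  obtain q x0 and f :: "'a \<Rightarrow>\<^sub>L real" where q: "q > 0" and x0: "x0 > 0" "Q x0 = q *\<^sub>R x0"
      and f: "positive_op f" "f \<noteq> 0" "\<And>x. f (Q x) = q * f x"
    using Krein_Rutman[OF Qcomp Qpos growth] by blast
  define y where "y = R x0"
  define g where "g = f o\<^sub>L R"
  have y: "y > 0" "quasi_interior y"
    using R_gt R_qi x0(1) by (simp_all add: y_def)
  have gpos: "positive_op g"
    using f(1) Rpos by (simp add: g_def positive_op_compose)
  have "g \<noteq> 0"
  proof
    assume "g = 0"
    then have "f (R (c *\<^sub>R x - T x)) = 0" for x
      by (metis blinfun_apply_blinfun_compose g_def zero_blinfun.rep_eq)
    then have "f x = 0" for x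
      using R by (simp add: positive_resolvent_def)
    then show False
      using f(2) by (metis blinfun_eqI zero_blinfun.rep_eq)
  qed
  have g_strict: "g x > 0" if "x > 0" for x
  proof (rule ideal_irreducible_strictly_positive[OF T(1,2) gpos \<open>g \<noteq> 0\<close> _ that])
    show "g (T x) \<le> c * g x" if "x \<ge> 0" for x
      using f(1) that by (simp add: g_def RT blinfun.diff_right blinfun.scaleR_right positive_op_def)
  qed
  define D where "D = (T o\<^sub>L K) - (K o\<^sub>L T)"
  have D: "positive_op D \<or> positive_op (- D)"
    using semi by (simp add: semi_commute_def D_def)
  \<comment> \<open>As \<open>R\<close> commutes with \<open>T\<close>, the commutators of \<open>Q\<close> with \<open>T\<close> and with \<open>R\<close> are products of \<open>D\<close> with
    positive operators, and inherit its sign.\<close>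
  have RD: "(R o\<^sub>L D) = (T o\<^sub>L Q) - (Q o\<^sub>L T)"
    by (rule blinfun_eqI) (simp add: D_def Q_def blinfun.diff_left blinfun.diff_right TR RT)
  have RDR: "(R o\<^sub>L D o\<^sub>L R) = (R o\<^sub>L K) - (K o\<^sub>L R)"
    by (rule blinfun_eqI)
      (simp add: D_def blinfun.diff_left blinfun.diff_right blinfun.scaleR_right TR RT)
  have RRDR: "(R o\<^sub>L R o\<^sub>L D o\<^sub>L R) = (R o\<^sub>L Q) - (Q o\<^sub>L R)"
  proof (rule blinfun_eqI)
    fix x
    have "R (D (R x)) = R (K x) - K (R x)"
      using RDR by (metis blinfun.diff_left blinfun_apply_blinfun_compose)
    then show "(R o\<^sub>L R o\<^sub>L D o\<^sub>L R) x = ((R o\<^sub>L Q) - (Q o\<^sub>L R)) x"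
      by (simp add: Q_def blinfun.diff_left blinfun.diff_right)
  qed
  have neg: "A o\<^sub>L (- B) = - (A o\<^sub>L B)" "(- A) o\<^sub>L B = - (A o\<^sub>L B)" for A B :: "'a \<Rightarrow>\<^sub>L 'a"
    by (auto intro!: blinfun_eqI simp: blinfun.minus_left blinfun.minus_right)
  have "\<exists>E. positive_op E \<and> (E = (R o\<^sub>L Q) - (Q o\<^sub>L R) \<or> E = (Q o\<^sub>L R) - (R o\<^sub>L Q))"
    using D
  proof
    assume "positive_op D"
    then have "positive_op (R o\<^sub>L R o\<^sub>L D o\<^sub>L R)"
      using Rpos by (intro positive_op_compose)
    then show ?thesis
      using RRDR by metis
  next
    assume "positive_op (- D)"
    then have "positive_op (R o\<^sub>L R o\<^sub>L (- D) o\<^sub>L R)"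
      using Rpos by (intro positive_op_compose)
    then show ?thesis
      by (metis RRDR neg minus_diff_eq)
  qed
  then obtain E where E: "positive_op E" "E = (R o\<^sub>L Q) - (Q o\<^sub>L R) \<or> E = (Q o\<^sub>L R) - (R o\<^sub>L Q)"
    by blast
  have Qy: "Q y = q *\<^sub>R y" and gQ: "g (Q x) = q * g x" for x
    using eigenpair_transfer[OF _ x0(2) f(1,3) E Rpos] x0(1) y(2) g_strict
    by (auto simp: y_def g_def order_less_le)
  have "R o\<^sub>L D = 0"
    using D
  proof
    assume "positive_op D"
    then have "positive_op (R o\<^sub>L D)"
      using Rpos by (intro positive_op_compose)
    then show ?thesis
      using positive_commutator_eq_0[OF y(2) _ Qy g_strict gQ, of "R o\<^sub>L D" T] y(1) RD by auto
  next
    assume "positive_op (- D)"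
    then have "positive_op (R o\<^sub>L (- D))"
      using Rpos by (intro positive_op_compose)
    then have "positive_op (- (R o\<^sub>L D))"
      by (simp add: neg)
    then have "- (R o\<^sub>L D) = 0"
      using positive_commutator_eq_0[OF y(2) _ Qy g_strict gQ, of "- (R o\<^sub>L D)" T] y(1) RD by auto
    then show ?thesis
      by simp
  qed
  then have "R (D x) = 0" for x
    by (metis blinfun_apply_blinfun_compose zero_blinfun.rep_eq)
  then have "D x = 0" for x
    using R_inj by blast
  then have TK: "T (K x) = K (T x)" for x
    by (simp add: D_def blinfun.diff_left)
  have KR: "K (R x) = R (K x)" for x
  proof -
    have "(R o\<^sub>L D o\<^sub>L R) x = 0"
      using \<open>R o\<^sub>L D = 0\<close> by simp
    then show ?thesis
      by (simp add: RDR blinfun.diff_left)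
  qed
  have TQ: "T (Q x) = Q (T x)" for x
    by (simp add: Q_def TR RT TK[symmetric])
  have KQ: "K (Q x) = Q (K x)" for x
    by (simp add: Q_def KR)
  have ker: "x = (g x / g y) *\<^sub>R y" if "Q x = q *\<^sub>R x" for x
  proof (rule eigenspace_one_dimensional[OF Qpos _ y(1) Qy g_strict gQ _ that])
    fix x assume x: "x > 0" "Q x = q *\<^sub>R x"
    then have "R (K (x /\<^sub>R q)) = x"
      using q by (simp add: Q_def blinfun.scaleR_right)
    moreover have "x /\<^sub>R q \<ge> 0"
      using x(1) q by (intro scaleR_nonneg_nonneg) auto
    then have "K (x /\<^sub>R q) \<ge> 0"
      using K(2) by (simp add: positive_op_def)
    ultimately show "quasi_interior x"
      using R_qi[of "K (x /\<^sub>R q)"] x(1) by (cases "K (x /\<^sub>R q) = 0") (auto simp: order_less_le)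
  qed (use q in auto)
  have gy: "g y > 0"
    using g_strict y(1) .
  define t where "t = g (T y) / g y"
  define r where "r = g (K y) / g y"
  have Ty: "T y = t *\<^sub>R y"
    unfolding t_def by (rule ker) (simp add: TQ[symmetric] Qy blinfun.scaleR_right)
  have Ky: "K y = r *\<^sub>R y"
    unfolding r_def by (rule ker) (simp add: KQ[symmetric] Qy blinfun.scaleR_right)
  have gT: "g (T x) = t * g x" for x
    using eigenfunctional_unique[OF Qcomp q _ gQ _ ker, of "g o\<^sub>L T" x] gy
    by (simp add: t_def TQ gQ)
  have gK: "g (K x) = r * g x" for x
    using eigenfunctional_unique[OF Qcomp q _ gQ _ ker, of "g o\<^sub>L K" x] gy
    by (simp add: r_def KQ gQ)
  have "T y \<noteq> 0" "K y \<noteq> 0"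
    using positive_op_eq_0_if_quasi_interior[OF T(2) y(2)] T(3)
      positive_op_eq_0_if_quasi_interior[OF K(2) y(2)] K(3) by blast+
  then have "T y > 0" "K y > 0"
    using T(2) K(2) y(1) by (auto simp: positive_op_def order_less_le)
  then have tr: "t > 0" "r > 0"
    using g_strict gy by (simp_all add: t_def r_def)
  have kerT: "x = (g x / g y) *\<^sub>R y" if "T x = t *\<^sub>R x" for x
  proof (rule eigenspace_one_dimensional[OF T(2) _ y(1) Ty g_strict gT _ that])
    show "quasi_interior x" if "x > 0" "T x = t *\<^sub>R x" for x
      using ideal_irreducible_quasi_interior[OF T(1,2) that(1), of t] that(2) by simp
  qed (use tr in auto)
  show thesis
    using that[OF y gpos g_strict tr Ty Ky gT gK kerT] .
qed

section \<open>The spectral radius of compact positive operators\<close>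

lemma complex_scale_simps [simp]:
  "complex_scale a (complex_scale b z) = complex_scale (a * b) z"
  "complex_scale 1 z = z" "complex_scale a 0 = 0"
  "complex_scale (complex_of_real t) (x, 0) = (t *\<^sub>R x, 0)"
  by (simp_all add: complex_scale_def algebra_simps prod_eq_iff)

lemma complex_scale_diff: "complex_scale a (z - w) = complex_scale a z - complex_scale a w"
  by (simp add: complex_scale_def algebra_simps)

text \<open>The product norm is not homogeneous for complex scalars; it is so up to a constant factor,
  whose size is immaterial.\<close>

lemma norm_complex_scale_le:
  fixes z :: "'a::real_normed_vector \<times> 'a"
  shows "norm (complex_scale c z) \<le> norm z * (4 * cmod c)"
proof -
  have fs: "norm (fst z) \<le> norm z" "norm (snd z) \<le> norm z"
    using norm_fst_le norm_snd_le by (metis prod.collapse)+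
  have "norm (a *\<^sub>R x) \<le> cmod c * norm z" if "\<bar>a\<bar> \<le> cmod c" "norm x \<le> norm z" for a and x :: 'a
    using that by (simp add: mult_mono)
  note parts = this[OF abs_Re_le_cmod fs(1)] this[OF abs_Re_le_cmod fs(2)]
    this[OF abs_Im_le_cmod fs(1)] this[OF abs_Im_le_cmod fs(2)]
  have "norm (complex_scale c z) \<le> norm (Re c *\<^sub>R fst z - Im c *\<^sub>R snd z)
      + norm (Re c *\<^sub>R snd z + Im c *\<^sub>R fst z)"
    unfolding complex_scale_def by (rule norm_Pair_le)
  also have "\<dots> \<le> (norm (Re c *\<^sub>R fst z) + norm (Im c *\<^sub>R snd z))
      + (norm (Re c *\<^sub>R snd z) + norm (Im c *\<^sub>R fst z))"
    by (intro add_mono norm_triangle_ineq norm_triangle_ineq4)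
  finally have "norm (complex_scale c z) \<le> 4 * (cmod c * norm z)"
    using parts by linarith
  then show ?thesis
    by (simp add: mult_ac)
qed

lemma bounded_linear_complex_scale: "bounded_linear (complex_scale c)"
proof (rule bounded_linear_intro)
  show "norm (complex_scale c z) \<le> norm z * (4 * cmod c)" for z :: "'a \<times> 'a"
    by (rule norm_complex_scale_le)
qed (simp_all add: complex_scale_def algebra_simps)

lemma norm_complexify_op_le: "norm (complexify_op A z) \<le> norm z * (2 * norm A)"
proof -
  have fs: "norm (fst z) \<le> norm z" "norm (snd z) \<le> norm z"
    using norm_fst_le norm_snd_le by (metis prod.collapse)+
  have "norm (complexify_op A z) \<le> norm (A (fst z)) + norm (A (snd z))"
    unfolding complexify_op_def by (rule norm_Pair_le)
  also have "\<dots> \<le> norm A * norm z + norm A * norm z"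
    using fs by (intro add_mono order_trans[OF norm_blinfun] mult_left_mono) auto
  finally show ?thesis
    by (simp add: mult_ac)
qed

lemma bounded_linear_complexify_op: "bounded_linear (complexify_op A)"
proof (rule bounded_linear_intro)
  show "norm (complexify_op A z) \<le> norm z * (2 * norm A)" for z
    by (rule norm_complexify_op_le)
qed (simp_all add: complexify_op_def blinfun.add_right blinfun.scaleR_right)

definition scaled_complexification ::
    "complex \<Rightarrow> ('a::real_normed_vector \<Rightarrow>\<^sub>L 'a) \<Rightarrow> ('a \<times> 'a) \<Rightarrow>\<^sub>L ('a \<times> 'a)" where
  "scaled_complexification c A = Blinfun (\<lambda>z. complex_scale (inverse c) (complexify_op A z))"

lemma scaled_complexification_apply:
  "scaled_complexification c A z = complex_scale (inverse c) (complexify_op A z)"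
  unfolding scaled_complexification_def
  by (rule bounded_linear_Blinfun_apply[THEN fun_cong])
    (rule bounded_linear_compose[OF bounded_linear_complex_scale bounded_linear_complexify_op])

lemma not_in_spectrum_op:
  assumes c: "c \<noteq> 0" and N: "bounded_linear N" "\<And>z. N (z - scaled_complexification c A z) = z"
    "\<And>z. N z - scaled_complexification c A (N z) = z"
  shows "c \<notin> spectrum_op A"
proof -
  have factor: "complex_scale c z - complexify_op A z
      = complex_scale c (z - scaled_complexification c A z)" for z
    using c by (simp add: scaled_complexification_apply complex_scale_diff)
  have "bounded_linear (\<lambda>z. N (complex_scale (inverse c) z))"
    using N(1) bounded_linear_complex_scale by (rule bounded_linear_compose)
  moreover have "N (complex_scale (inverse c) (complex_scale c z - complexify_op A z)) = z" for z
    using c by (simp add: factor N(2))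
  moreover have "complex_scale c (N (complex_scale (inverse c) z))
      - complexify_op A (N (complex_scale (inverse c) z)) = z" for z
    using c by (simp add: factor N(3))
  ultimately show ?thesis
    unfolding spectrum_op_def by (auto intro!: exI[of _ "\<lambda>z. N (complex_scale (inverse c) z)"])
qed

lemma bdd_above_spectrum_op:
  fixes A :: "'a::banach \<Rightarrow>\<^sub>L 'a"
  shows "bdd_above (cmod ` spectrum_op A)"
proof (rule bdd_aboveI2)
  fix c assume c: "c \<in> spectrum_op A"
  show "cmod c \<le> 8 * norm A"
  proof (rule ccontr)
    assume "\<not> cmod c \<le> 8 * norm A"
    then have gt: "8 * norm A < cmod c" and c0: "c \<noteq> 0"
      using norm_ge_zero[of A] by auto
    have "norm (scaled_complexification c A) \<le> 8 * norm A / cmod c"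
    proof (rule norm_blinfun_bound)
      fix z
      have "norm (scaled_complexification c A z) \<le> norm (complexify_op A z) * (4 * cmod (inverse c))"
        unfolding scaled_complexification_apply by (rule norm_complex_scale_le)
      also have "\<dots> \<le> norm z * (2 * norm A) * (4 * cmod (inverse c))"
        by (intro mult_right_mono norm_complexify_op_le) auto
      finally show "norm (scaled_complexification c A z) \<le> 8 * norm A / cmod c * norm z"
        by (simp add: norm_inverse divide_inverse mult.assoc mult.commute mult.left_commute)
    qed simp
    also have "\<dots> < 1"
      using gt c0 by (simp add: divide_less_eq)
    finally obtain N where "\<And>x. N (x - scaled_complexification c A x) = x"
        "\<And>x. N x - scaled_complexification c A (N x) = x" "bounded_linear N"
      using Neumann_series blinfun.bounded_linear_right by (metis (no_types, lifting))
    then have "c \<notin> spectrum_op A"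
      using not_in_spectrum_op[OF c0] by blast
    then show False
      using c by contradiction
  qed
qed

lemma eigenvalue_in_spectrum_op:
  fixes A :: "'a::real_normed_vector \<Rightarrow>\<^sub>L 'a"
  assumes "A y = a *\<^sub>R y" "y \<noteq> 0"
  shows "complex_of_real a \<in> spectrum_op A"
proof -
  have "False" if "bounded_linear R"
    and R: "\<And>z. R (complex_scale (complex_of_real a) z - complexify_op A z) = z"
    for R :: "'a \<times> 'a \<Rightarrow> 'a \<times> 'a"
  proof -
    have "R 0 = 0"
      using that(1) by (intro linear_0 bounded_linear.linear)
    moreover have "complex_scale (complex_of_real a) (y, 0) - complexify_op A (y, 0) = 0"
      using assms(1) by (simp add: complexify_op_def prod_eq_iff)
    ultimately have "(y, 0) = (0 :: 'a \<times> 'a)"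
      using R[of "(y, 0)"] by metis
    then show False
      using assms(2) by (simp add: prod_eq_iff)
  qed
  then show ?thesis
    unfolding spectrum_op_def by blast
qed

lemma eigenvalue_le_spectral_radius_op:
  fixes A :: "'a::banach \<Rightarrow>\<^sub>L 'a"
  assumes "A y = a *\<^sub>R y" "y \<noteq> 0"
  shows "a \<le> spectral_radius_op A"
proof -
  have "cmod (complex_of_real a) \<le> spectral_radius_op A"
    unfolding spectral_radius_op_def
    using bdd_above_spectrum_op by (intro cSup_upper imageI eigenvalue_in_spectrum_op[OF assms])
  then show ?thesis
    by simp
qed

lemma compact_op_scaled_complexification:
  assumes "compact_op A"
  shows "compact_op (scaled_complexification c A)"
proof (rule compact_opI)
  let ?C = "closure (A ` cball 0 1)"
  show "scaled_complexification c A ` cball 0 1 \<subseteq> complex_scale (inverse c) ` (?C \<times> ?C)"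
  proof (rule image_subsetI)
    fix z :: "'a \<times> 'a" assume z: "z \<in> cball 0 1"
    have "norm (fst z) \<le> norm z" "norm (snd z) \<le> norm z"
      using norm_fst_le norm_snd_le by (metis prod.collapse)+
    then have "fst z \<in> cball 0 1" "snd z \<in> cball 0 1"
      using z by auto
    then have "complexify_op A z \<in> ?C \<times> ?C"
      using closure_subset[of "A ` cball 0 1"] by (auto simp: complexify_op_def)
    then show "scaled_complexification c A z \<in> complex_scale (inverse c) ` (?C \<times> ?C)"
      unfolding scaled_complexification_apply by (rule imageI)
  qed
  show "compact (complex_scale (inverse c) ` (?C \<times> ?C))"
    using assms unfolding compact_op_def
    by (intro compact_continuous_image compact_Times
        linear_continuous_on[OF bounded_linear_complex_scale])
qed

text \<open>By the Fredholm alternative, a nonzero point of the spectrum is an eigenvalue of the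
  complexification. The seminorm \<open>p (x, y) = g \<bar>x\<bar> + g \<bar>y\<bar>\<close>, which is a norm because \<open>g\<close> is strictly
  positive, grows at most by the factor \<open>a\<close> under \<open>A\<close>, but along an eigenvector by \<open>\<bar>c\<bar>\<close>, up to a
  constant independent of the number of iterations.\<close>

lemma spectrum_op_le_strictly_positive_eigenfunctional:
  fixes A :: "'a::banach_lattice \<Rightarrow>\<^sub>L 'a" and g :: "'a \<Rightarrow>\<^sub>L real"
  assumes A: "compact_op A" "positive_op A" and a: "a > 0"
    and g: "positive_op g" "\<And>x. x > 0 \<Longrightarrow> g x > 0" "\<And>x. g (A x) = a * g x"
    and c: "c \<in> spectrum_op A"
  shows "cmod c \<le> a"
proof (rule ccontr)
  assume gt: "\<not> cmod c \<le> a"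
  then have c0: "c \<noteq> 0"
    using a by auto
  have "\<exists>z. scaled_complexification c A z = z \<and> z \<noteq> 0"
  proof (rule ccontr)
    assume "\<not> ?thesis"
    then obtain N where "bounded_linear N" "\<And>z. N (z - scaled_complexification c A z) = z"
        "\<And>z. N z - scaled_complexification c A (N z) = z"
      using Fredholm_alternative[OF compact_op_scaled_complexification[OF A(1)], of c] by blast
    then show False
      using not_in_spectrum_op[OF c0] c by blast
  qed
  then obtain z where z: "complex_scale (inverse c) (complexify_op A z) = z" "z \<noteq> 0"
    by (auto simp: scaled_complexification_apply)
  have Az: "complexify_op A z = complex_scale c z"
    using arg_cong[OF z(1), of "complex_scale c"] c0 by simp
  define p where "p w = g \<bar>fst w\<bar> + g \<bar>snd w\<bar>" for w :: "'a \<times> 'a"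
  have p_A: "p (complexify_op A w) \<le> a * p w" for w
  proof -
    have "g \<bar>A x\<bar> \<le> a * g \<bar>x\<bar>" for x
      using positive_op_mono[OF g(1) positive_op_abs[OF A(2), of x]] by (simp add: g(3))
    then show ?thesis
      unfolding p_def complexify_op_def by (simp add: distrib_left add_mono)
  qed
  have p_nonneg: "g \<bar>x\<bar> \<ge> 0" for x
    using g(1) by (simp add: positive_op_def)
  have p_scale: "p (complex_scale b w) \<le> 2 * cmod b * p w" for b w
  proof -
    have abs: "g \<bar>s *\<^sub>R x\<bar> \<le> cmod b * g \<bar>x\<bar>" if "\<bar>s\<bar> \<le> cmod b" for s and x :: 'a
    proof -
      have "g \<bar>s *\<^sub>R x\<bar> \<le> \<bar>s\<bar> * g \<bar>x\<bar>"
        using positive_op_mono[OF g(1) abs_scaleR_le[of s x]] by (simp add: blinfun.scaleR_right)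
      also have "\<dots> \<le> cmod b * g \<bar>x\<bar>"
        using that p_nonneg by (rule mult_right_mono)
      finally show ?thesis .
    qed
    have add: "g \<bar>u + v\<bar> \<le> g \<bar>u\<bar> + g \<bar>v\<bar>" for u v
      using positive_op_mono[OF g(1) abs_triangle_ineq[of u v]] by (simp add: blinfun.add_right)
    have diff: "g \<bar>u - v\<bar> \<le> g \<bar>u\<bar> + g \<bar>v\<bar>" for u v
      using add[of u "- v"] by simp
    have "p (complex_scale b w) \<le> (g \<bar>Re b *\<^sub>R fst w\<bar> + g \<bar>Im b *\<^sub>R snd w\<bar>)
        + (g \<bar>Re b *\<^sub>R snd w\<bar> + g \<bar>Im b *\<^sub>R fst w\<bar>)"
      unfolding p_def complex_scale_def using add diff by (simp add: add_mono)
    then show ?thesis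
      using abs[OF abs_Re_le_cmod, of "fst w"] abs[OF abs_Re_le_cmod, of "snd w"]
        abs[OF abs_Im_le_cmod, of "fst w"] abs[OF abs_Im_le_cmod, of "snd w"]
      unfolding p_def by (simp add: algebra_simps)
  qed
  have p_pow: "p (complex_scale (c ^ n) z) \<le> a ^ n * p z" for n
  proof (induction n)
    case (Suc n)
    have "complexify_op A (complex_scale (c ^ n) z) = complex_scale (c ^ n) (complexify_op A z)"
      by (simp add: complexify_op_def complex_scale_def blinfun.add_right blinfun.diff_right
          blinfun.scaleR_right)
    then have "complex_scale (c ^ Suc n) z = complexify_op A (complex_scale (c ^ n) z)"
      by (simp add: Az mult.commute)
    then have "p (complex_scale (c ^ Suc n) z) \<le> a * p (complex_scale (c ^ n) z)"
      using p_A by metis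
    also have "\<dots> \<le> a * (a ^ n * p z)"
      using Suc a by simp
    finally show ?case
      by (simp add: mult.assoc)
  qed simp
  have "p z \<le> (a / cmod c) ^ n * (2 * p z)" for n
  proof -
    have "p z = p (complex_scale (inverse (c ^ n)) (complex_scale (c ^ n) z))"
      using c0 by simp
    also have "\<dots> \<le> 2 * cmod (inverse (c ^ n)) * p (complex_scale (c ^ n) z)"
      by (rule p_scale)
    also have "\<dots> \<le> 2 * cmod (inverse (c ^ n)) * (a ^ n * p z)"
      by (intro mult_left_mono p_pow) auto
    finally show ?thesis
      by (simp add: norm_inverse norm_power power_divide divide_inverse power_inverse
          power_mult_distrib mult_ac)
  qed
  moreover have "(\<lambda>n. (a / cmod c) ^ n * (2 * p z)) \<longlonglongrightarrow> 0 * (2 * p z)"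
    using a gt by (intro tendsto_intros LIMSEQ_power_zero) (auto simp: divide_less_eq)
  ultimately have "p z \<le> 0"
    by (intro LIMSEQ_le_const[of _ 0 "p z"]) auto
  then have "g \<bar>fst z\<bar> = 0" "g \<bar>snd z\<bar> = 0"
    using p_nonneg[of "fst z"] p_nonneg[of "snd z"] unfolding p_def by linarith+
  then have "fst z = 0" "snd z = 0"
    using g(2)[of "\<bar>fst z\<bar>"] g(2)[of "\<bar>snd z\<bar>"] by (auto simp: order_less_le)
  then show False
    using z(2) by (simp add: prod_eq_iff)
qed

lemma spectral_radius_op_eq:
  fixes A :: "'a::banach_lattice \<Rightarrow>\<^sub>L 'a" and g :: "'a \<Rightarrow>\<^sub>L real"
  assumes A: "compact_op A" "positive_op A" and a: "a > 0"
    and g: "positive_op g" "\<And>x. x > 0 \<Longrightarrow> g x > 0" "\<And>x. g (A x) = a * g x"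
    and y: "A y = a *\<^sub>R y" "y \<noteq> 0"
  shows "spectral_radius_op A = a"
proof (rule antisym)
  show "spectral_radius_op A \<le> a"
    unfolding spectral_radius_op_def
    using eigenvalue_in_spectrum_op[OF y] spectrum_op_le_strictly_positive_eigenfunctional[OF A a g]
    by (intro cSup_least) auto
  show "a \<le> spectral_radius_op A"
    by (rule eigenvalue_le_spectral_radius_op[OF y])
qed

section \<open>Invariant ideals\<close>

text \<open>A strictly positive eigenfunctional keeps all positive orbits, and a quasi-interior eigenvector all
  positive adjoint orbits, from growing more slowly than the powers of the eigenvalue.\<close>

lemma le_liminf_orbit:
  fixes A :: "'a::banach_lattice \<Rightarrow>\<^sub>L 'a" and g :: "'a \<Rightarrow>\<^sub>L real"
  assumes a: "a > 0" and g: "\<And>x. x > 0 \<Longrightarrow> g x > 0" "\<And>x. g (A x) = a * g x" and x: "x > 0"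
  shows "ereal a \<le> liminf (\<lambda>n. ereal (root n (norm (blinfun_pow A n x))))"
proof (rule le_liminf_root[OF _ a])
  have "norm g > 0"
    using g(1)[OF x] by auto
  then show "g x / norm g > 0"
    using g(1)[OF x] by simp
  fix n
  have "g (blinfun_pow A n x) = a ^ n * g x"
    by (induction n) (auto simp: g(2))
  then have "a ^ n * g x \<le> norm g * norm (blinfun_pow A n x)"
    using norm_blinfun[of g "blinfun_pow A n x"] by simp
  then show "g x / norm g * a ^ n \<le> norm (blinfun_pow A n x)"
    using \<open>norm g > 0\<close> by (simp add: field_simps)
qed

lemma le_liminf_adjoint_orbit:
  fixes A :: "'a::banach_lattice \<Rightarrow>\<^sub>L 'a" and f :: "'a \<Rightarrow>\<^sub>L real"
  assumes a: "a > 0" and y: "quasi_interior y" "y > 0" "A y = a *\<^sub>R y" and f: "op_less 0 f"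
  shows "ereal a \<le> liminf (\<lambda>n. ereal (root n (norm (banach_adjoint (blinfun_pow A n) f))))"
proof (rule le_liminf_root[OF _ a])
  have fpos: "positive_op f" "f \<noteq> 0"
    using f by (auto simp: op_less_def)
  have "f y \<noteq> 0"
    using positive_op_eq_0_if_quasi_interior[OF fpos(1) y(1)] fpos(2) by blast
  then have "f y > 0"
    using fpos(1) y(2) by (auto simp: positive_op_def order_less_le)
  then show "f y / norm y > 0"
    using y(2) by simp
  fix n
  have "f y * a ^ n = banach_adjoint (blinfun_pow A n) f y"
    by (simp add: banach_adjoint_def blinfun_pow_eigenvector[OF y(3)] blinfun.scaleR_right)
  also have "\<dots> \<le> norm (banach_adjoint (blinfun_pow A n) f) * norm y"
    using norm_blinfun[of "banach_adjoint (blinfun_pow A n) f" y] by simp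
  finally show "f y / norm y * a ^ n \<le> norm (banach_adjoint (blinfun_pow A n) f)"
    using y(2) by (simp add: field_simps)
qed

theorem proposition4p2:
  fixes T K :: "'a::banach_lattice \<Rightarrow>\<^sub>L 'a"
  assumes dim_gt_1: "\<exists>B :: 'a set. independent B \<and> finite B \<and> card B > 1"
    and "T \<noteq> 0" and "K \<noteq> 0"
    and "positive_op T" and "positive_op K"
    and "semi_commute T K"
    and "compact_op K"
    and cases:
     "( spectral_radius_op K = 0
      \<or> (\<exists>x::'a. x > 0 \<and>
           liminf (\<lambda>n. ereal (root n (norm (blinfun_pow K n x)))) < ereal (spectral_radius_op K))
      \<or> (\<exists>f :: 'a \<Rightarrow>\<^sub>L real. op_less 0 f \<and>
           liminf (\<lambda>n. ereal (root n (norm (banach_adjoint (blinfun_pow K n) f))))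
             < ereal (spectral_radius_op K)))
    \<or> ( spectral_radius_op (T o\<^sub>L K) = 0
      \<or> (spectral_radius_op K > 0 \<and> (\<exists>x::'a. x > 0 \<and>
           liminf (\<lambda>n. ereal (root n (norm (blinfun_pow T n x))))
             < ereal (spectral_radius_op (T o\<^sub>L K) / spectral_radius_op K)))
      \<or> (spectral_radius_op K > 0 \<and> (\<exists>f :: 'a \<Rightarrow>\<^sub>L real. op_less 0 f \<and>
           liminf (\<lambda>n. ereal (root n (norm (banach_adjoint (blinfun_pow T n) f))))
             < ereal (spectral_radius_op (T o\<^sub>L K) / spectral_radius_op K))))
    \<or> (\<exists>S :: 'a \<Rightarrow>\<^sub>L 'a. quasi_nilpotent S \<and> op_less 0 S \<and> semi_commute S T)
    \<or> (\<exists>S :: 'a \<Rightarrow>\<^sub>L 'a. op_less (S o\<^sub>L T) (T o\<^sub>L S) \<or> op_less (T o\<^sub>L S) (S o\<^sub>L T))"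
  shows "\<exists>J :: 'a set. nontrivial_closed_ideal J \<and> invariant_under T J"
proof (rule ccontr)
  assume "\<not> ?thesis"
  then have irr: "ideal_irreducible T"
    by (simp add: ideal_irreducible_def)
  obtain y t r and g :: "'a \<Rightarrow>\<^sub>L real"
    where y: "y > 0" "quasi_interior y" and g: "positive_op g" "\<And>x. x > 0 \<Longrightarrow> g x > 0"
      and tr: "t > 0" "r > 0" and Ty: "T y = t *\<^sub>R y" and Ky: "K y = r *\<^sub>R y"
      and gT: "\<And>x. g (T x) = t * g x" and gK: "\<And>x. g (K x) = r * g x"
      and ker: "\<And>x. T x = t *\<^sub>R x \<Longrightarrow> x = (g x / g y) *\<^sub>R y"
    by (rule common_eigenvectors[OF irr assms(4,2,7,5,3,6)]) (rule that)
  have y0: "y \<ge> 0" "y \<noteq> 0"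
    using y(1) by auto
  have rK: "spectral_radius_op K = r"
    by (rule spectral_radius_op_eq[OF assms(7,5) tr(2) g gK Ky y0(2)])
  have rTK: "spectral_radius_op (T o\<^sub>L K) = t * r"
  proof (rule spectral_radius_op_eq[OF _ _ _ g _ _ y0(2)])
    show "compact_op (T o\<^sub>L K)" "positive_op (T o\<^sub>L K)"
      using assms(4,5,7) by (simp_all add: compact_op_compose_left positive_op_compose)
  qed (use tr in \<open>auto simp: gT gK Ty Ky blinfun.scaleR_right\<close>)
  note commutator = positive_commutator_eq_0[OF y(2) y0(1) Ty g(2) gT]
  have "\<not> (quasi_nilpotent S \<and> op_less 0 S \<and> semi_commute S T)" for S
  proof
    assume S: "quasi_nilpotent S \<and> op_less 0 S \<and> semi_commute S T"
    then have Spos: "positive_op S" "S \<noteq> 0"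
      by (auto simp: op_less_def)
    have "(S o\<^sub>L T) - (T o\<^sub>L S) = 0 \<or> (T o\<^sub>L S) - (S o\<^sub>L T) = 0"
      using S commutator unfolding semi_commute_def by blast
    then have "S o\<^sub>L T = T o\<^sub>L S"
      by auto
    then have "T (S y) = S (T y)"
      by (metis blinfun_apply_blinfun_compose)
    then have "T (S y) = t *\<^sub>R S y"
      by (simp add: Ty blinfun.scaleR_right)
    then have Sy: "S y = (g (S y) / g y) *\<^sub>R y"
      by (rule ker)
    have "S y \<noteq> 0"
      using positive_op_eq_0_if_quasi_interior[OF Spos(1) y(2)] Spos(2) by blast
    then have "S y > 0"
      using Spos(1) y0 by (auto simp: positive_op_def order_less_le)
    then have "0 < g (S y) / g y"
      using g(2) y(1) by simp
    also have "\<dots> \<le> spectral_radius_op S"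
      by (rule eigenvalue_le_spectral_radius_op[OF Sy y0(2)])
    finally show False
      using S by (simp add: quasi_nilpotent_def)
  qed
  moreover have "\<not> (op_less (S o\<^sub>L T) (T o\<^sub>L S) \<or> op_less (T o\<^sub>L S) (S o\<^sub>L T))" for S
    using commutator[of "(T o\<^sub>L S) - (S o\<^sub>L T)" S] commutator[of "(S o\<^sub>L T) - (T o\<^sub>L S)" S]
    by (auto simp: op_less_def)
  moreover note le_liminf_orbit[of r g K, OF tr(2) g(2) gK] le_liminf_orbit[of t g T, OF tr(1) g(2) gT]
    le_liminf_adjoint_orbit[OF tr(2) y(2,1) Ky] le_liminf_adjoint_orbit[OF tr(1) y(2,1) Ty]
  ultimately show False
    using cases tr unfolding rK rTK by (auto simp: not_le[symmetric])
qed

end
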